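(* Let $G$ be a graph of order $n$ (i.e. with $n$ vertices) different from $K_1$ and $K_4$. Then $$h_t(G)\le \left\lceil \tfrac{3}{2}n\right\rceil .$$
   Context: Graphs are finite and simple; $K_m$ denotes the complete graph on $m$ vertices, and "different from" means not isomorphic to. A total colouring of a graph $G$ is an assignment of colours to both the vertices and the edges of $G$ (from a common set of colours) such that adjacent vertices receive different colours, adjacent edges (distinct edges sharing an endpoint) receive different colours, and every edge receives a colour different from the colours of its end vertices. A harmonious total colouring of $G$ is a total colouring $c$ with the additional property that, when for each incident pair $(v,e)$ of a vertex $v$ and an edge $e$ one writes the unordered pair of colours $\{c(v),c(e)\}$, each unordered pair of colours occurs at most once; that is, for distinct incident pairs $(v,e)\ne(w,f)$ one has $\{c(v),c(e)\}\neq\{c(w),c(f)\}$. The harmonious total chromatic number $h_t(G)$ is the smallest number of colours in a harmonious total colouring of $G$. *)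

theory Defs
  imports Complex_Main
begin

text \<open>An undirected graph is a pair of a vertex set and a set of edges, an edge being the
  two-element set of its end vertices.\<close>

type_synonym 'a ugraph = "'a set \<times> 'a set set"

definition verts :: "'a ugraph \<Rightarrow> 'a set" where
  "verts G = fst G"

definition edges :: "'a ugraph \<Rightarrow> 'a set set" where
  "edges G = snd G"

definition finite_simple_graph :: "'a ugraph \<Rightarrow> bool" where
  "finite_simple_graph G \<longleftrightarrow>
     finite (verts G) \<and> (\<forall>e\<in>edges G. e \<subseteq> verts G \<and> card e = 2)"

definition order_of :: "'a ugraph \<Rightarrow> nat" where
  "order_of G = card (verts G)"

definition isomorphic :: "'a ugraph \<Rightarrow> 'b ugraph \<Rightarrow> bool" where
  "isomorphic G H \<longleftrightarrow>
     (\<exists>f. bij_betw f (verts G) (verts H) \<and>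
        (\<forall>u\<in>verts G. \<forall>v\<in>verts G. {u, v} \<in> edges G \<longleftrightarrow> {f u, f v} \<in> edges H))"

definition complete_graph :: "nat \<Rightarrow> nat ugraph" where
  "complete_graph m = ({..<m}, {e. e \<subseteq> {..<m} \<and> card e = 2})"

text \<open>A colouring of vertices and edges from a common set of colours is given by two functions
  with the same codomain: \<open>cv\<close> on vertices and \<open>ce\<close> on edges.  Only their values on
  the vertices and edges of the graph matter.\<close>

definition total_colouring ::
    "'a ugraph \<Rightarrow> ('a \<Rightarrow> 'c) \<Rightarrow> ('a set \<Rightarrow> 'c) \<Rightarrow> bool" where
  "total_colouring G cv ce \<longleftrightarrow>
     (\<forall>u\<in>verts G. \<forall>v\<in>verts G. {u, v} \<in> edges G \<longrightarrow> cv u \<noteq> cv v) \<and>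
     (\<forall>e\<in>edges G. \<forall>f\<in>edges G. e \<noteq> f \<and> e \<inter> f \<noteq> {} \<longrightarrow> ce e \<noteq> ce f) \<and>
     (\<forall>e\<in>edges G. \<forall>v\<in>e. ce e \<noteq> cv v)"

definition incident_pairs :: "'a ugraph \<Rightarrow> ('a \<times> 'a set) set" where
  "incident_pairs G = {(v, e). v \<in> verts G \<and> e \<in> edges G \<and> v \<in> e}"

definition harmonious_total_colouring ::
    "'a ugraph \<Rightarrow> ('a \<Rightarrow> 'c) \<Rightarrow> ('a set \<Rightarrow> 'c) \<Rightarrow> bool" where
  "harmonious_total_colouring G cv ce \<longleftrightarrow>
     total_colouring G cv ce \<and>
     (\<forall>(v, e)\<in>incident_pairs G. \<forall>(w, f)\<in>incident_pairs G.
        (v, e) \<noteq> (w, f) \<longrightarrow> {cv v, ce e} \<noteq> {cv w, ce f})"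

definition colours_used ::
    "'a ugraph \<Rightarrow> ('a \<Rightarrow> 'c) \<Rightarrow> ('a set \<Rightarrow> 'c) \<Rightarrow> 'c set" where
  "colours_used G cv ce = cv ` verts G \<union> ce ` edges G"

text \<open>Natural numbers serve as the supply of colours; as there are infinitely many, every finite
  graph has a harmonious total colouring with them and the minimum exists.\<close>

definition harmonious_total_chromatic_number :: "'a ugraph \<Rightarrow> nat" where
  "harmonious_total_chromatic_number G =
     (LEAST k. \<exists>(cv :: 'a \<Rightarrow> nat) (ce :: 'a set \<Rightarrow> nat).
        harmonious_total_colouring G cv ce \<and> card (colours_used G cv ce) = k)"

end

theory Submission
  imports Defs "HOL-Number_Theory.Cong"
begin

text \<open>
  Give the vertices of the complete graph \<open>K\<^sub>n\<close> pairwise different colours,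
  so that a vertex colour can be identified with its vertex. A colouring of the edges by the
  \<open>n\<close> vertices and \<open>q\<close> extra colours then gives a harmonious total
  colouring if and only if every colour class is a matching and there are no vertices
  \<open>u\<close>, \<open>w\<close> (equal or not) such that \<open>w\<close> colours an edge
  at \<open>u\<close> and \<open>u\<close> colours an edge at \<open>w\<close>. Both conditions
  survive the removal of edges from a class, so it is enough to cover the edges of
  \<open>K\<^sub>n\<close> by matchings of this kind, one for each colour; a graph of order
  \<open>n\<close> then inherits the colouring (\<open>harmonious_bound_of_scheme\<close>). The
  theorem asks for \<open>q = \<lceil>n / 2\<rceil>\<close>.

  Split the vertices into two halves. The extra colours cover the edges between the halves, by
  means of a Latin square. What remains are the edges inside the halves, which the vertices
  themselves have to colour. Identify most of each half with the integers modulo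
  \<open>r\<close> and let the colour \<open>w\<close> join, in a given half, the points at
  distances \<open>a\<close> and \<open>m - a\<close> ahead of \<open>w\<close>, for
  \<open>a\<close> in an interval. Such a reflection is a matching; the differences of its edges
  run through one parity class up to some bound, and rotating \<open>w\<close> yields all edges
  with these differences. In each half the colours of that half and those of the other one are
  given sums \<open>m\<close> of different parity, and this covers nearly every edge. The clash
  condition only says that an interval must not meet the negative of the interval used in the
  opposite direction.

  For \<open>r = 2h\<close> the edges left over are the antipodal ones, and the pairs
  \<open>u\<close>, \<open>w\<close> that do not serve any edge group the \<open>4h\<close>
  points into \<open>h\<close> sets of four whose six pairs are all unused. Adding one, two or
  three vertices, and paying for the new edges with these pairs, gives all orders \<open>4h +
  1\<close>, \<open>4h + 2\<close> and \<open>4h + 3\<close>. For an odd order one vertex, the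
  apex, belongs to neither half; extra colours join it to half of the other vertices, which is
  possible when the Latin square has a transversal. This is why order 5 needs a separate
  colouring: no Latin square of order 2 has a transversal. For the orders \<open>4k + 4\<close>
  the modulus is \<open>2k + 1\<close> and one vertex is added to each half. The cyclic pattern
  misses a Hamiltonian cycle in one half; the two added vertices colour all of its edges but
  one, and a local exchange of colours takes care of the last one. This construction needs
  \<open>k \<ge> 1\<close>, and for order 4 a colouring is needed only for graphs that miss an
  edge of \<open>K\<^sub>4\<close>.
\<close>

section \<open>From families of matchings to harmonious total colourings\<close>

text \<open>The class of the colour \<open>c\<close> is given as a symmetric relation \<open>M c\<close>;
  \<open>Inl w\<close> is the colour of the vertex \<open>w\<close> and \<open>Inr b\<close> is
  an extra colour. The third condition with \<open>u = w\<close> says that no edge gets the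
  colour of one of its ends. Only edges in \<open>E\<close> have to be covered: for order 4
  there is no scheme with two extra colours that covers all edges of \<open>K\<^sub>4\<close>.\<close>

definition matching_scheme ::
    "'v set \<Rightarrow> nat \<Rightarrow> ('v \<Rightarrow> 'v \<Rightarrow> bool) \<Rightarrow> ('v + nat \<Rightarrow> 'v \<Rightarrow> 'v \<Rightarrow> bool) \<Rightarrow> bool" where
  "matching_scheme V q E M \<longleftrightarrow>
     (\<forall>c u v. M c u v \<longrightarrow> M c v u) \<and>
     (\<forall>c u v v'. M c u v \<longrightarrow> M c u v' \<longrightarrow> v = v') \<and>
     (\<forall>u w v v'. M (Inl w) u v \<longrightarrow> \<not> M (Inl u) w v') \<and>
     (\<forall>u\<in>V. \<forall>v\<in>V. u \<noteq> v \<longrightarrow> E u v \<longrightarrow> (\<exists>c \<in> V <+> {..<q}. M c u v))"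

lemma matching_schemeI:
  assumes "\<And>c u v. M c u v \<Longrightarrow> M c v u"
    and "\<And>c u v v'. M c u v \<Longrightarrow> M c u v' \<Longrightarrow> v = v'"
    and "\<And>u w v v'. M (Inl w) u v \<Longrightarrow> M (Inl u) w v' \<Longrightarrow> False"
    and "\<And>u v. u \<in> V \<Longrightarrow> v \<in> V \<Longrightarrow> u \<noteq> v \<Longrightarrow> E u v \<Longrightarrow>
           (\<exists>w\<in>V. M (Inl w) u v) \<or> (\<exists>b<q. M (Inr b) u v)"
  shows "matching_scheme V q E M"
  unfolding matching_scheme_def
proof (intro conjI allI ballI impI notI)
  fix u v assume "u \<in> V" "v \<in> V" "u \<noteq> v" "E u v"
  from assms(4)[OF this] show "\<exists>c \<in> V <+> {..<q}. M c u v" by auto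
qed (fact assms(1-3))+

text \<open>Colour each vertex by itself and each edge by any colour whose class contains it. If two
  incident pairs show the same pair of colours, then either the vertices and the edge colours
  agree, and the edges coincide because a class is a matching, or the colours are crossed, which
  is the clash that the third condition of a scheme forbids.\<close>

lemma harmonious_bound_of_scheme:
  fixes G :: "'a ugraph" and V :: "'v set"
  assumes G: "finite_simple_graph G"
    and f: "bij_betw f (verts G) V"
    and fE: "\<And>u v. {u, v} \<in> edges G \<Longrightarrow> E (f u) (f v)"
    and S: "matching_scheme V q E M"
  shows "harmonious_total_chromatic_number G \<le> order_of G + q"
proof -
  have finV: "finite V"
    using G f bij_betw_finite unfolding finite_simple_graph_def by blast
  define C where "C = V <+> {..<q}"
  have finC: "finite C" and cardC: "card C = order_of G + q"
    using finV f by (auto simp: C_def card_Plus order_of_def bij_betw_same_card)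
  obtain enc :: "'v + nat \<Rightarrow> nat" where enc: "inj_on enc C"
    using finC finite_imp_inj_to_nat_seg by blast
  have sym: "M c u v \<Longrightarrow> M c v u" and uniq: "M c u v \<Longrightarrow> M c u v' \<Longrightarrow> v = v'"
    and anti: "M (Inl w) u v \<Longrightarrow> \<not> M (Inl u) w v'" for c u v v' w
    using S unfolding matching_scheme_def by blast+
  have edge: "\<exists>u v. e = {u, v} \<and> u \<noteq> v \<and> u \<in> verts G \<and> v \<in> verts G" if "e \<in> edges G" for e
    using G that unfolding finite_simple_graph_def by (metis card_2_iff insert_subset)
  have fin: "f u \<in> V" if "u \<in> verts G" for u
    using f that by (auto simp: bij_betw_def)
  have finj: "u = v" if "f u = f v" "u \<in> verts G" "v \<in> verts G" for u v
    using f that by (auto simp: bij_betw_def inj_on_def)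
  have "\<exists>c\<in>C. \<forall>u v. e = {u, v} \<longrightarrow> M c (f u) (f v)" if e: "e \<in> edges G" for e
  proof -
    obtain u v where uv: "e = {u, v}" "u \<noteq> v" "u \<in> verts G" "v \<in> verts G"
      using edge[OF e] by blast
    have "f u \<noteq> f v" using uv finj by blast
    then obtain c where "c \<in> C" "M c (f u) (f v)"
      using S uv fE[of u v] e fin unfolding matching_scheme_def C_def by metis
    then show ?thesis using uv sym by (metis doubleton_eq_iff)
  qed
  then obtain ch where chC: "\<And>e. e \<in> edges G \<Longrightarrow> ch e \<in> C"
    and ch: "\<And>u v. {u, v} \<in> edges G \<Longrightarrow> M (ch {u, v}) (f u) (f v)"
    by metis
  define cv where "cv u = enc (Inl (f u))" for u
  define ce where "ce e = enc (ch e)" for e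
  have InlC: "Inl (f u) \<in> C" if "u \<in> verts G" for u
    using fin[OF that] by (auto simp: C_def)
  have cv_eq: "cv u = cv v \<longleftrightarrow> u = v" if "u \<in> verts G" "v \<in> verts G" for u v
    using inj_on_eq_iff[OF enc InlC[OF that(1)] InlC[OF that(2)]] finj[OF _ that]
    by (auto simp: cv_def)
  have ce_eq: "ce e = ce e' \<longleftrightarrow> ch e = ch e'" if "e \<in> edges G" "e' \<in> edges G" for e e'
    using inj_on_eq_iff[OF enc chC[OF that(1)] chC[OF that(2)]] by (simp add: ce_def)
  have ce_cv: "ce e = cv u \<longleftrightarrow> ch e = Inl (f u)" if "e \<in> edges G" "u \<in> verts G" for e u
    using inj_on_eq_iff[OF enc chC[OF that(1)] InlC[OF that(2)]] by (simp add: ce_def cv_def)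
  have other: "\<exists>v. e = {u, v} \<and> v \<in> verts G \<and> M (ch e) (f u) (f v)" if "e \<in> edges G" "u \<in> e" for e u
    using edge[OF that(1)] that ch by (metis insert_commute insert_iff singletonD)
  have same: "e = e'" if "e \<in> edges G" "e' \<in> edges G" "u \<in> e" "u \<in> e'" "ch e = ch e'" for e e' u
    using other[OF that(1,3)] other[OF that(2,4)] that(5) uniq finj by metis
  have inG: "u \<in> verts G" if "e \<in> edges G" "u \<in> e" for e u
    using edge[OF that(1)] that(2) by blast
  have tc: "total_colouring G cv ce"
    unfolding total_colouring_def
  proof (intro conjI ballI impI)
    fix u v assume "u \<in> verts G" "v \<in> verts G" "{u, v} \<in> edges G"
    then show "cv u \<noteq> cv v" using edge[of "{u, v}"] cv_eq by (metis doubleton_eq_iff)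
  next
    fix e e' assume "e \<in> edges G" "e' \<in> edges G" "e \<noteq> e' \<and> e \<inter> e' \<noteq> {}"
    then show "ce e \<noteq> ce e'" using same ce_eq by blast
  next
    fix e u assume e: "e \<in> edges G" "u \<in> e"
    show "ce e \<noteq> cv u"
      using ce_cv[OF e(1) inG[OF e]] other[OF e] anti by metis
  qed
  have pairs: "(v, e) = (w, e')"
    if ve: "v \<in> e" "e \<in> edges G" and we: "w \<in> e'" "e' \<in> edges G"
      and eq: "{cv v, ce e} = {cv w, ce e'}" for v e w e'
  proof (cases "cv v = cv w \<and> ce e = ce e'")
    case True
    then show ?thesis
      using cv_eq[OF inG[OF ve(2,1)] inG[OF we(2,1)]] ce_eq[OF ve(2) we(2)] same[OF ve(2) we(2) ve(1)] we(1)
      by simp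
  next
    case False
    then have "ch e' = Inl (f v)" "ch e = Inl (f w)"
      using eq ce_cv[OF ve(2) inG[OF we(2,1)]] ce_cv[OF we(2) inG[OF ve(2,1)]]
      by (auto simp: doubleton_eq_iff)
    then show ?thesis using other[OF ve(2,1)] other[OF we(2,1)] anti by metis
  qed
  have harm: "harmonious_total_colouring G cv ce"
    unfolding harmonious_total_colouring_def
  proof (intro conjI tc ballI, clarify)
    fix v e w e' assume "(v, e) \<in> incident_pairs G" "(w, e') \<in> incident_pairs G"
      and ne: "\<not> (v = w \<and> e = e')" and eq: "{cv v, ce e} = {cv w, ce e'}"
    then have "v \<in> e" "e \<in> edges G" "w \<in> e'" "e' \<in> edges G"
      by (simp_all add: incident_pairs_def)
    then have "(v, e) = (w, e')" using eq by (rule pairs)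
    then show False using ne by simp
  qed
  have "harmonious_total_chromatic_number G \<le> card (colours_used G cv ce)"
    unfolding harmonious_total_chromatic_number_def using harm by (intro Least_le) blast
  also have "\<dots> \<le> card (enc ` C)"
    using finC InlC chC by (intro card_mono) (auto simp: colours_used_def cv_def ce_def)
  also have "\<dots> \<le> order_of G + q"
    using card_image_le[OF finC, of enc] cardC by simp
  finally show ?thesis .
qed

section \<open>Latin squares and the edges between two halves\<close>

text \<open>A Latin square whose main diagonal is a transversal.\<close>

definition diagonal_latin_square :: "nat \<Rightarrow> (nat \<Rightarrow> nat \<Rightarrow> nat) \<Rightarrow> bool" where
  "diagonal_latin_square N L \<longleftrightarrow>
     (\<forall>i<N. \<forall>j<N. L i j < N) \<and>
     (\<forall>i<N. inj_on (L i) {..<N}) \<and>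
     (\<forall>j<N. inj_on (\<lambda>i. L i j) {..<N}) \<and>
     inj_on (\<lambda>i. L i i) {..<N}"

lemma add_mod_inj:
  fixes i j k N :: nat
  assumes "i < N" "j < N" "(k + i) mod N = (k + j) mod N"
  shows "i = j"
  using assms by (metis cong_add_lcancel_nat cong_def mod_less)

lemma double_mod_inj:
  fixes i j N :: nat
  assumes "odd N" "i < N" "j < N" "(i + i) mod N = (j + j) mod N"
  shows "i = j"
proof -
  have "[2 * i = 2 * j] (mod N)" using assms by (simp add: cong_def mult_2)
  then have "[i = j] (mod N)" using assms(1) cong_mult_lcancel_nat by auto
  then show ?thesis using assms by (simp add: cong_def)
qed

lemma diagonal_latin_square_odd:
  "odd N \<Longrightarrow> diagonal_latin_square N (\<lambda>i j. (i + j) mod N)"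
  unfolding diagonal_latin_square_def
  by (auto intro!: inj_onI dest: add_mod_inj double_mod_inj simp: add.commute)

text \<open>Prolongation of the cyclic square of odd order \<open>r\<close>: the cells \<open>(i, i +
  1)\<close> form a transversal; their symbols move to the new row and column, and the new
  symbol \<open>r\<close> takes their place. The diagonal of the old square is disjoint from
  this transversal, and together with the new corner it is a transversal of the larger square.
  For \<open>r = 1\<close> the two transversals coincide.\<close>

lemma diagonal_latin_square_even:
  assumes "odd r" "r \<noteq> 1"
  defines "L \<equiv> \<lambda>i j. if i < r \<and> j < r then (if j = (i + 1) mod r then r else (i + j) mod r)
             else if i < r then (i + (i + 1)) mod r
             else if j < r then (j + (j + (r - 1))) mod r else r"
  shows "diagonal_latin_square (r + 1) L"
proof -
  have r: "r \<ge> 3" using assms by (cases "r = 0"; cases "r = 2") auto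
  have less: "x mod r < r" for x using r by simp
  have ne: "x mod r \<noteq> r" "r \<noteq> x mod r" for x using less[of x] by simp_all
  have succ_inj: "i = j" if "i < r" "j < r" "(i + 1) mod r = (j + 1) mod r" for i j
    using add_mod_inj[OF that(1,2), of 1] that(3) by (simp add: add.commute)
  have succ_ne: "(i + 1) mod r \<noteq> i" if "i < r" for i
    using r that by (cases "i + 1 = r") auto
  have row: "j = (i + 1) mod r" if "i < r" "j < r" "(i + j) mod r = (i + (i + 1)) mod r" for i j
  proof -
    have "(i + j) mod r = (i + (i + 1) mod r) mod r" using that(3) by (simp add: mod_add_right_eq)
    then show ?thesis using add_mod_inj[OF that(2) less] by blast
  qed
  have pred_succ: "(((j + (r - 1)) mod r) + 1) mod r = j" if "j < r" for j
    using that r by (simp add: mod_simps)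
  have col: "j = (i + 1) mod r" if "i < r" "j < r" "(i + j) mod r = (j + (j + (r - 1))) mod r" for i j
  proof -
    have "(j + i) mod r = (j + (j + (r - 1)) mod r) mod r"
      using that(3) by (simp add: mod_add_right_eq add.commute)
    then have "i = (j + (r - 1)) mod r" using add_mod_inj[OF that(1) less] by blast
    then show ?thesis using pred_succ that(2) by simp
  qed
  have dbl1: "i = j" if "i < r" "j < r" "(i + (i + 1)) mod r = (j + (j + 1)) mod r" for i j
  proof -
    have "[(i + i) + 1 = (j + j) + 1] (mod r)" using that(3) by (simp add: cong_def add.assoc)
    then have "[i + i = j + j] (mod r)" using cong_add_rcancel_nat by blast
    then show ?thesis using double_mod_inj[OF assms(1) that(1,2)] by (simp add: cong_def)
  qed
  have dbl2: "i = j" if "i < r" "j < r" "(i + (i + (r - 1))) mod r = (j + (j + (r - 1))) mod r" for i j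
  proof -
    have "[(i + i) + (r - 1) = (j + j) + (r - 1)] (mod r)" using that(3) by (simp add: cong_def add.assoc)
    then have "[i + i = j + j] (mod r)" using cong_add_rcancel_nat by blast
    then show ?thesis using double_mod_inj[OF assms(1) that(1,2)] by (simp add: cong_def)
  qed
  have add_inj': "i = j" if "i < r" "j < r" "(i + k) mod r = (j + k) mod r" for i j k
    using add_mod_inj[OF that(1,2), of k] that(3) by (simp add: add.commute)
  define A t D F where "A i j = (i + j) mod r" and "t i = (i + 1) mod r"
    and "D i = (i + (i + 1)) mod r" and "F j = (j + (j + (r - 1))) mod r" for i j
  note defs = A_def t_def D_def F_def
  have L: "L i j = (if i < r \<and> j < r then (if j = t i then r else A i j)
             else if i < r then D i else if j < r then F j else r)" for i j
    by (simp only: L_def defs)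
  have bnd: "A i j < r" "D i < r" "F i < r" for i j
    unfolding defs by (rule less)+
  have factA: "i < r \<Longrightarrow> j < r \<Longrightarrow> A i j = D i \<Longrightarrow> j = t i"
    "i < r \<Longrightarrow> j < r \<Longrightarrow> A i j = F j \<Longrightarrow> j = t i" for i j
    unfolding defs by (rule row col; assumption)+
  have factB: "i < r \<Longrightarrow> j < r \<Longrightarrow> D i = D j \<Longrightarrow> i = j"
    "i < r \<Longrightarrow> j < r \<Longrightarrow> F i = F j \<Longrightarrow> i = j"
    "i < r \<Longrightarrow> j < r \<Longrightarrow> t i = t j \<Longrightarrow> i = j" for i j
    unfolding defs by (erule dbl1 dbl2 succ_inj; assumption)+
  have factC: "i < r \<Longrightarrow> j < r \<Longrightarrow> A k i = A k j \<Longrightarrow> i = j"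
    "i < r \<Longrightarrow> j < r \<Longrightarrow> A i k = A j k \<Longrightarrow> i = j"
    "i < r \<Longrightarrow> j < r \<Longrightarrow> A i i = A j j \<Longrightarrow> i = j" for i j k
    unfolding defs by (erule add_mod_inj add_inj' double_mod_inj[OF assms(1)]; assumption)+
  have factD: "i < r \<Longrightarrow> t i \<noteq> i" for i
    unfolding defs by (rule succ_ne)
  have neq: "A i j \<noteq> r" "D i \<noteq> r" "F i \<noteq> r" "r \<noteq> A i j" "r \<noteq> D i" "r \<noteq> F i" for i j
    using bnd by (metis less_irrefl)+
  have "L i j < r + 1" for i j
    using bnd[THEN less_SucI] by (simp add: L)
  moreover have "inj_on (L i) {..<r + 1}" if "i < r + 1" for i
  proof (rule inj_onI)
    fix j j' assume "j \<in> {..<r + 1}" "j' \<in> {..<r + 1}" and eq: "L i j = L i j'"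
    then have J: "j < r \<or> j = r" "j' < r \<or> j' = r" by auto
    show "j = j'"
    proof (cases "i < r")
      case True
      then show ?thesis
        using J eq True factA(1)[OF True, of j] factA(1)[OF True, of j'] factC(1)[of j j' i]
          neq(4,5)[of i] unfolding L by (smt (verit) less_irrefl)
    next
      case False
      then show ?thesis using J eq factB(2)[of j j'] neq(3,6) by (auto simp: L split: if_splits)
    qed
  qed
  moreover have "inj_on (\<lambda>i. L i j) {..<r + 1}" if "j < r + 1" for j
  proof (rule inj_onI)
    fix i i' assume "i \<in> {..<r + 1}" "i' \<in> {..<r + 1}" and eq: "L i j = L i' j"
    then have I: "i < r \<or> i = r" "i' < r \<or> i' = r" by auto
    show "i = i'"
    proof (cases "j < r")
      case True
      then show ?thesis
        using I eq True factA(2)[OF _ True, of i] factA(2)[OF _ True, of i'] factB(3)[of i i']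
          factC(2)[of i i' j] neq(4)[of _ j] neq(6)[of j] unfolding L by (smt (verit) less_irrefl)
    next
      case False
      then show ?thesis using I eq factB(1)[of i i'] neq(2,5) by (auto simp: L split: if_splits)
    qed
  qed
  moreover have "inj_on (\<lambda>i. L i i) {..<r + 1}"
  proof (rule inj_onI)
    fix i i' assume "i \<in> {..<r + 1}" "i' \<in> {..<r + 1}" and eq: "L i i = L i' i'"
    then have I: "i < r \<or> i = r" "i' < r \<or> i' = r" by auto
    then show "i = i'"
      using eq factD[of i] factD[of i'] factC(3)[of i i'] neq(1,4)
      by (auto simp: L split: if_splits)
  qed
  ultimately show ?thesis unfolding diagonal_latin_square_def by blast
qed

lemma diagonal_latin_square_exists:
  assumes "N \<noteq> 0" "N \<noteq> 2"
  shows "\<exists>L. diagonal_latin_square N L"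
proof (cases "odd N")
  case False
  then obtain r where r: "N = r + 1" "odd r" "r \<noteq> 1"
    using assms by (cases N) auto
  show ?thesis unfolding r(1) by (rule exI, rule diagonal_latin_square_even[OF r(2,3)])
qed (use diagonal_latin_square_odd in blast)

lemma bipartite_matchings:
  assumes "finite X" "finite Y" "X \<inter> Y = {}" "card X = N" "card Y = N"
  shows "\<exists>S :: nat \<Rightarrow> 'v \<Rightarrow> 'v \<Rightarrow> bool.
     (\<forall>c u v. S c u v \<longrightarrow> S c v u) \<and> (\<forall>c u v v'. S c u v \<longrightarrow> S c u v' \<longrightarrow> v = v') \<and>
     (\<forall>u\<in>X. \<forall>v\<in>Y. \<exists>c<N. S c u v)"
proof -
  obtain f g where f: "bij_betw f X {..<N}" and g: "bij_betw g Y {..<N}"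
    using assms finite_same_card_bij[of _ "{..<N}"] by (metis card_lessThan finite_lessThan)
  have fl: "u \<in> X \<Longrightarrow> f u < N" and gl: "v \<in> Y \<Longrightarrow> g v < N" for u v
    using f g by (auto simp: bij_betw_def)
  have fi: "u \<in> X \<Longrightarrow> u' \<in> X \<Longrightarrow> f u = f u' \<Longrightarrow> u = u'"
    and gi: "v \<in> Y \<Longrightarrow> v' \<in> Y \<Longrightarrow> g v = g v' \<Longrightarrow> v = v'" for u u' v v'
    using f g by (auto simp: bij_betw_def inj_on_def)
  define T where "T c u v \<longleftrightarrow> u \<in> X \<and> v \<in> Y \<and> (f u + g v) mod N = c" for c u v
  define S where "S c u v \<longleftrightarrow> T c u v \<or> T c v u" for c u v
  have "v = v'" if "S c u v" "S c u v'" for c u v v'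
  proof (cases "u \<in> X")
    case True
    then have "v \<in> Y" "v' \<in> Y" "(f u + g v) mod N = (f u + g v') mod N"
      using that assms(3) by (auto simp: S_def T_def)
    then show ?thesis using add_mod_inj gl gi by metis
  next
    case False
    then have "v \<in> X" "v' \<in> X" "(g u + f v) mod N = (g u + f v') mod N"
      using that assms(3) by (auto simp: S_def T_def add.commute)
    then show ?thesis using add_mod_inj fl fi by metis
  qed
  moreover have "\<exists>c<N. S c u v" if "u \<in> X" "v \<in> Y" for u v
    using that fl[OF that(1)]
    by (intro exI[of _ "(f u + g v) mod N"]) (simp add: S_def T_def)
  ultimately show ?thesis by (intro exI[of _ S]) (auto simp: S_def)
qed

text \<open>Used to index two sets of equal size in such a way that the elements with equal index lie on
  prescribed sides of a partition.\<close>

lemma bij_betw_initial_segment: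
  assumes "finite A" "B \<subseteq> A" "card A = N" "card B = j"
  shows "\<exists>f. bij_betw f A {..<N} \<and> (\<forall>a\<in>A. f a < j \<longleftrightarrow> a \<in> B)"
proof -
  have B: "finite B" "finite (A - B)" "card (A - B) = N - j" "j \<le> N"
    using assms by (auto simp: card_Diff_subset finite_subset card_mono)
  obtain f1 where f1: "bij_betw f1 B {..<j}"
    using B assms(4) finite_same_card_bij[of B "{..<j}"] by auto
  obtain f2 where f2: "bij_betw f2 (A - B) {j..<N}"
    using B finite_same_card_bij[of "A - B" "{j..<N}"] by auto
  define f where "f a = (if a \<in> B then f1 a else f2 a)" for a
  have b1: "bij_betw f B {..<j}" using f1 by (subst bij_betw_cong[of _ _ f1]) (auto simp: f_def)
  have b2: "bij_betw f (A - B) {j..<N}" using f2 by (subst bij_betw_cong[of _ _ f2]) (auto simp: f_def)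
  have "bij_betw f (B \<union> (A - B)) ({..<j} \<union> {j..<N})"
    by (rule bij_betw_combine[OF b1 b2]) auto
  moreover have "B \<union> (A - B) = A" "{..<j} \<union> {j..<N} = {..<N}" using assms(2) B(4) by auto
  moreover have "f a < j \<longleftrightarrow> a \<in> B" if "a \<in> A" for a
    using bij_betwE[OF b1] bij_betwE[OF b2] that by (cases "a \<in> B") force+
  ultimately show ?thesis by metis
qed

text \<open>Number \<open>X\<close> and \<open>Y\<close> so that of the two vertices with the same number
  exactly one lies in \<open>P\<close>; the sizes fit because \<open>card P = N\<close>. Colour
  by a Latin square, but move its diagonal, a transversal, to the additional colour
  \<open>N\<close>. This frees the symbol in the diagonal cell \<open>i\<close> at both vertices
  with number \<open>i\<close>, and the edge from \<open>z\<close> to the one in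
  \<open>P\<close> takes it; the symbols at \<open>z\<close> differ as they come from different
  cells of a transversal.\<close>

lemma bipartite_apex_matchings:
  assumes fin: "finite X" "finite Y" and disj: "X \<inter> Y = {}" and card: "card X = N" "card Y = N"
    and P: "P \<subseteq> X \<union> Y" "card P = N" and z: "z \<notin> X \<union> Y" and N: "N \<noteq> 2"
  shows "\<exists>S :: nat \<Rightarrow> 'v \<Rightarrow> 'v \<Rightarrow> bool.
     (\<forall>c u v. S c u v \<longrightarrow> S c v u) \<and> (\<forall>c u v v'. S c u v \<longrightarrow> S c u v' \<longrightarrow> v = v') \<and>
     (\<forall>u\<in>X. \<forall>v\<in>Y. \<exists>c<N + 1. S c u v) \<and> (\<forall>p\<in>P. \<exists>c<N + 1. S c p z)"
proof (cases "N = 0")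
  case True
  then have "X = {}" "P = {}" using assms by (auto simp: finite_subset)
  then show ?thesis by (intro exI[of _ "\<lambda>_ _ _. False"]) auto
next
  case False
  then obtain L where L: "diagonal_latin_square N L" using diagonal_latin_square_exists N by blast
  have Ll: "L i j < N" if "i < N" "j < N" for i j
    using L that by (simp add: diagonal_latin_square_def)
  have Lr: "j = j'" if "i < N" "j < N" "j' < N" "L i j = L i j'" for i j j'
  proof -
    have "inj_on (L i) {..<N}" using L that(1) by (simp add: diagonal_latin_square_def)
    then show ?thesis using that(2-4) by (auto dest: inj_onD)
  qed
  have Lc: "i = i'" if "i < N" "j < N" "i' < N" "L i j = L i' j" for i i' j
  proof -
    have "inj_on (\<lambda>i. L i j) {..<N}" using L that(2) by (simp add: diagonal_latin_square_def)
    then show ?thesis using that(1,3,4) by (auto dest: inj_onD)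
  qed
  have Ld: "i = i'" if "i < N" "i' < N" "L i i = L i' i'" for i i'
  proof -
    have "inj_on (\<lambda>i. L i i) {..<N}" using L by (simp add: diagonal_latin_square_def)
    then show ?thesis using that by (auto dest: inj_onD)
  qed
  define j where "j = card (X \<inter> P)"
  have "card P = card (X \<inter> P) + card (Y \<inter> P)"
    using P(1) disj fin by (subst card_Un_disjoint[symmetric]) (auto intro!: arg_cong[of _ _ card])
  moreover have "card (Y - P) = N - card (Y \<inter> P)" "card (Y \<inter> P) \<le> N"
    using fin(2) card(2) card_Diff_subset_Int[of Y P] card_mono[of Y "Y \<inter> P"] by simp_all
  ultimately have jY: "card (Y - P) = j" using P(2) unfolding j_def by simp
  obtain f where f: "bij_betw f X {..<N}" "\<And>u. u \<in> X \<Longrightarrow> f u < j \<longleftrightarrow> u \<in> P"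
    using bij_betw_initial_segment[of X "X \<inter> P" N j] fin card j_def by auto
  obtain g where g: "bij_betw g Y {..<N}" "\<And>v. v \<in> Y \<Longrightarrow> g v < j \<longleftrightarrow> v \<notin> P"
    using bij_betw_initial_segment[of Y "Y - P" N j] fin card jY by auto
  define ix where "ix u = (if u \<in> X then f u else g u)" for u
  have ixl: "ix u < N" if "u \<in> X \<union> Y" for u
    using that f(1) g(1) by (auto simp: ix_def bij_betw_def)
  have ixX: "u = u'" if "u \<in> X" "u' \<in> X" "ix u = ix u'" for u u'
    using that f(1) by (auto simp: ix_def bij_betw_def inj_on_def)
  have ixY: "u = u'" if "u \<in> Y" "u' \<in> Y" "ix u = ix u'" for u u'
    using that g(1) disj by (auto simp: ix_def bij_betw_def inj_on_def split: if_splits)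
  have ixXY: "u \<in> P \<longleftrightarrow> v \<notin> P" if "u \<in> X" "v \<in> Y" "ix u = ix v" for u v
    using that f(2)[of u] g(2)[of v] disj by (auto simp: ix_def split: if_splits)
  have ixP: "u = u'" if "u \<in> P" "u' \<in> P" "ix u = ix u'" for u u'
  proof -
    have "u \<in> X \<or> u \<in> Y" "u' \<in> X \<or> u' \<in> Y" using that P(1) by auto
    then consider "u \<in> X" "u' \<in> X" | "u \<in> Y" "u' \<in> Y" | "u \<in> X" "u' \<in> Y" | "u' \<in> X" "u \<in> Y"
      by blast
    then show ?thesis
    proof cases
      case 1 then show ?thesis using that(3) by (rule ixX)
    next
      case 2 then show ?thesis using that(3) by (rule ixY)
    next
      case 3 then show ?thesis using ixXY[OF 3 that(3)] that(1,2) by simp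
    next
      case 4 then show ?thesis using ixXY[OF 4 that(3)[symmetric]] that(1,2) by simp
    qed
  qed
  define T where "T c u v \<longleftrightarrow>
      u \<in> X \<and> v \<in> Y \<and> c = (if ix u = ix v then N else L (ix u) (ix v)) \<or>
      u \<in> P \<and> v = z \<and> c = L (ix u) (ix u)" for c u v
  define S where "S c u v \<longleftrightarrow> T c u v \<or> T c v u" for c u v
  have zP: "z \<notin> X" "z \<notin> Y" "z \<notin> P" using z P(1) by auto
  have uniq: "v = v'" if sv: "S c u v" "S c u v'" for c u v v'
  proof -
    consider "u \<in> X" "u \<notin> Y" "u \<noteq> z" | "u \<in> Y" "u \<notin> X" "u \<noteq> z" | "u = z"
      using sv disj zP P(1) by (auto simp: S_def T_def)
    then show ?thesis
    proof cases
      case 1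
      then have *: "w \<in> Y \<and> c = (if ix u = ix w then N else L (ix u) (ix w)) \<or>
                 w = z \<and> c = L (ix u) (ix u)" if "S c u w" for w
        using that zP by (auto simp: S_def T_def)
      have iu: "ix u < N" using ixl 1 by blast
      have lt: "L (ix u) (ix u) < N" "w \<in> Y \<Longrightarrow> L (ix u) (ix w) < N" for w
        using iu ixl Ll by auto
      have diag: "w \<in> Y \<Longrightarrow> L (ix u) (ix w) = L (ix u) (ix u) \<Longrightarrow> ix w = ix u" for w
        using Lr[OF iu _ iu] ixl by blast
      have row: "w \<in> Y \<Longrightarrow> w' \<in> Y \<Longrightarrow> L (ix u) (ix w) = L (ix u) (ix w') \<Longrightarrow> w = w'" for w w'
        using Lr[OF iu] ixl ixY by blast
      show ?thesis
        using *[OF sv(1)] *[OF sv(2)] lt(1) lt(2)[of v] lt(2)[of v'] diag[of v] diag[of v'] row[of v v']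
          ixY[of v v']
        by (auto split: if_splits)
    next
      case 2
      then have *: "w \<in> X \<and> c = (if ix w = ix u then N else L (ix w) (ix u)) \<or>
                 w = z \<and> c = L (ix u) (ix u)" if "S c u w" for w
        using that zP by (auto simp: S_def T_def)
      have iu: "ix u < N" using ixl 2 by blast
      have lt: "L (ix u) (ix u) < N" "w \<in> X \<Longrightarrow> L (ix w) (ix u) < N" for w
        using iu ixl Ll by auto
      have diag: "w \<in> X \<Longrightarrow> L (ix w) (ix u) = L (ix u) (ix u) \<Longrightarrow> ix w = ix u" for w
        using Lc[OF _ iu iu] ixl by blast
      have column: "w \<in> X \<Longrightarrow> w' \<in> X \<Longrightarrow> L (ix w) (ix u) = L (ix w') (ix u) \<Longrightarrow> w = w'" for w w'
        using Lc[OF _ iu] ixl ixX by blast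
      show ?thesis
        using *[OF sv(1)] *[OF sv(2)] lt(1) lt(2)[of v] lt(2)[of v'] diag[of v] diag[of v'] column[of v v']
          ixX[of v v']
        by (auto split: if_splits)
    next
      case 3
      then have "v \<in> P" "v' \<in> P" "L (ix v) (ix v) = L (ix v') (ix v')"
        using sv zP by (auto simp: S_def T_def)
      then show ?thesis using Ld ixl ixP P(1) by blast
    qed
  qed
  have "\<exists>c<N + 1. S c u v" if uv: "u \<in> X" "v \<in> Y" for u v
  proof (intro exI conjI)
    show "(if ix u = ix v then N else L (ix u) (ix v)) < N + 1"
      using Ll[OF ixl ixl, of u v] uv by simp
    show "S (if ix u = ix v then N else L (ix u) (ix v)) u v"
      unfolding S_def T_def using uv by blast
  qed
  moreover have "\<exists>c<N + 1. S c p z" if p: "p \<in> P" for p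
  proof (intro exI conjI)
    have "p \<in> X \<union> Y" using p P(1) by blast
    then show "L (ix p) (ix p) < N + 1" using Ll[OF ixl ixl, of p p] by simp
    show "S (L (ix p) (ix p)) p z" unfolding S_def T_def using p by blast
  qed
  moreover have "S c v u" if "S c u v" for c u v using that unfolding S_def by blast
  ultimately show ?thesis using uniq by blast
qed

section \<open>Orders 4h + 1, 4h + 2 and 4h + 3 from a frame on 4h points\<close>

text \<open>Clashes concern vertex colours only, so the classes of the vertices (\<open>A\<close>) and
  those of the extra colours (\<open>S\<close>) can be constructed independently.\<close>

lemma matching_scheme_combine:
  assumes "\<And>w u v. A w u v \<Longrightarrow> A w v u"
    and "\<And>w u v v'. A w u v \<Longrightarrow> A w u v' \<Longrightarrow> v = v'"
    and "\<And>w u v v'. A w u v \<Longrightarrow> A u w v' \<Longrightarrow> False"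
    and "\<forall>b u v. S b u v \<longrightarrow> S b v u"
    and "\<forall>b u v v'. S b u v \<longrightarrow> S b u v' \<longrightarrow> v = v'"
    and "\<And>u v. u \<in> V \<Longrightarrow> v \<in> V \<Longrightarrow> u \<noteq> v \<Longrightarrow> E u v \<Longrightarrow>
           (\<exists>w\<in>V. A w u v) \<or> (\<exists>b<q. S b u v)"
  shows "matching_scheme V q E (case_sum A S)"
proof (rule matching_schemeI)
  show "case_sum A S c v u" if "case_sum A S c u v" for c u v
    using that assms(1,4) by (cases c) auto
  show "v = v'" if "case_sum A S c u v" "case_sum A S c u v'" for c u v v'
  proof (cases c)
    case (Inl w)
    then have "A w u v" "A w u v'" using that by simp_all
    then show ?thesis by (rule assms(2))
  next
    case (Inr b)
    then show ?thesis using that assms(5) by auto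
  qed
qed (use assms(3,6) in auto)

text \<open>The points of a frame together with up to three further vertices. \<open>Inf s\<close> joins
  the half \<open>s\<close>; \<open>Apex\<close> belongs to neither half.\<close>

datatype 'a ext = Old 'a | Inf bool | Apex

text \<open>\<open>R w\<close> is the class of the colour \<open>w\<close>. The permutation
  \<open>\<sigma>\<close> splits \<open>V\<close> into orbits of four points such that no two
  points \<open>u\<close>, \<open>w\<close> of an orbit have \<open>w\<close> colouring an edge
  at \<open>u\<close>; so every orbit provides six unused pairs. The only edges inside a half
  that are still uncovered join the opposite points \<open>u\<close> and \<open>\<sigma>
  (\<sigma> u)\<close> of an orbit. The \<open>role\<close> numbers the points of an orbit in
  cyclic order.\<close>

locale quartered_frame =
  fixes V :: "'a set" and h :: nat and side :: "'a \<Rightarrow> bool" and R :: "'a \<Rightarrow> 'a \<Rightarrow> 'a \<Rightarrow> bool"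
    and \<sigma> :: "'a \<Rightarrow> 'a" and role :: "'a \<Rightarrow> nat"
  assumes fin: "finite V"
    and card_side: "card {u \<in> V. side u = s} = 2 * h"
    and R_in: "R w u v \<Longrightarrow> w \<in> V \<and> u \<in> V \<and> v \<in> V"
    and R_sym: "R w u v \<Longrightarrow> R w v u"
    and R_uniq: "R w u v \<Longrightarrow> R w u v' \<Longrightarrow> v = v'"
    and R_anti: "R w u v \<Longrightarrow> \<not> R u w v'"
    and \<sigma>_in: "u \<in> V \<Longrightarrow> \<sigma> u \<in> V"
    and role_less: "u \<in> V \<Longrightarrow> role u < 4"
    and role_\<sigma>: "u \<in> V \<Longrightarrow> role (\<sigma> u) = (role u + 1) mod 4"
    and \<sigma>4: "u \<in> V \<Longrightarrow> \<sigma> (\<sigma> (\<sigma> (\<sigma> u))) = u"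
    and side_\<sigma>2: "u \<in> V \<Longrightarrow> side (\<sigma> (\<sigma> u)) = side u"
    and R_free: "R w u v \<Longrightarrow> u \<noteq> \<sigma> w \<and> w \<noteq> \<sigma> u \<and> u \<noteq> \<sigma> (\<sigma> w)"
    and R_cover: "u \<in> V \<Longrightarrow> v \<in> V \<Longrightarrow> u \<noteq> v \<Longrightarrow> side u = side v \<Longrightarrow> v \<noteq> \<sigma> (\<sigma> u) \<Longrightarrow> \<exists>w. R w u v"
begin

lemma role_cases:
  assumes "u \<in> V"
  obtains "role u = 0" "role (\<sigma> u) = 1" "role (\<sigma> (\<sigma> u)) = 2" "role (\<sigma> (\<sigma> (\<sigma> u))) = 3"
  | "role u = 1" "role (\<sigma> u) = 2" "role (\<sigma> (\<sigma> u)) = 3" "role (\<sigma> (\<sigma> (\<sigma> u))) = 0"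
  | "role u = 2" "role (\<sigma> u) = 3" "role (\<sigma> (\<sigma> u)) = 0" "role (\<sigma> (\<sigma> (\<sigma> u))) = 1"
  | "role u = 3" "role (\<sigma> u) = 0" "role (\<sigma> (\<sigma> u)) = 1" "role (\<sigma> (\<sigma> (\<sigma> u))) = 2"
proof -
  have "role u = 0 \<or> role u = 1 \<or> role u = 2 \<or> role u = 3"
    using role_less[OF assms] by linarith
  then show thesis
    using that role_\<sigma> \<sigma>_in assms by auto
qed

lemma \<sigma>_neq:
  assumes "u \<in> V"
  shows "\<sigma> u \<noteq> u" "\<sigma> (\<sigma> u) \<noteq> u"
  using role_cases[OF assms] by fastforce+

text \<open>One point from each pair of opposite points; in extensions by the apex, these are the points
  that extra colours join to it.\<close>

definition first_half :: "'a set" where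
  "first_half = {u \<in> V. role u < 2}"

lemma first_half_in: "u \<in> first_half \<Longrightarrow> u \<in> V"
  by (simp add: first_half_def)

lemma first_half_opposite: "u \<in> V \<Longrightarrow> \<sigma> (\<sigma> u) \<in> first_half \<longleftrightarrow> u \<notin> first_half"
  by (rule role_cases[of u]) (auto simp: first_half_def \<sigma>_in)

lemma card_V: "card V = 4 * h"
proof -
  have "V = {u \<in> V. side u = True} \<union> {u \<in> V. side u = False}" by auto
  then have "card V = card {u \<in> V. side u = True} + card {u \<in> V. side u = False}"
    using fin by (subst card_Un_disjoint[symmetric]) auto
  then show ?thesis by (simp only: card_side)
qed

lemma card_first_half: "card first_half = 2 * h"
proof -
  have "bij_betw (\<lambda>u. \<sigma> (\<sigma> u)) first_half (V - first_half)"
    by (rule bij_betw_byWitness[where f' = "\<lambda>u. \<sigma> (\<sigma> u)"])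
      (auto simp: \<sigma>4 first_half_opposite \<sigma>_in first_half_in)
  then have "card first_half = card (V - first_half)" by (rule bij_betw_same_card)
  moreover have "card (V - first_half) = card V - card first_half" "card first_half \<le> card V"
    using fin by (auto simp: card_Diff_subset card_mono first_half_def)
  ultimately show ?thesis using card_V by simp
qed

text \<open>Let an orbit consist of \<open>a\<close>, \<open>b\<close>, \<open>a'\<close>,
  \<open>b'\<close> in the order of their roles. With the apex as the only new vertex, the edges
  \<open>aa'\<close>, \<open>bb'\<close> and the edges from the apex to \<open>a'\<close> and
  \<open>b'\<close> get the colours \<open>b\<close>, \<open>Apex\<close>, \<open>a\<close> and
  \<open>a'\<close>.\<close>

fun ext1 :: "'a ext \<Rightarrow> 'a ext \<Rightarrow> 'a ext \<Rightarrow> bool" where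
  "ext1 (Old w) (Old u) (Old v) \<longleftrightarrow> R w u v \<or>
     w \<in> V \<and> role w = 1 \<and> (u = \<sigma> w \<and> v = \<sigma> (\<sigma> (\<sigma> w)) \<or> v = \<sigma> w \<and> u = \<sigma> (\<sigma> (\<sigma> w)))"
| "ext1 (Old w) (Old u) Apex \<longleftrightarrow>
     w \<in> V \<and> (role w = 0 \<and> u = \<sigma> (\<sigma> w) \<or> role w = 2 \<and> u = \<sigma> w)"
| "ext1 (Old w) Apex (Old u) \<longleftrightarrow>
     w \<in> V \<and> (role w = 0 \<and> u = \<sigma> (\<sigma> w) \<or> role w = 2 \<and> u = \<sigma> w)"
| "ext1 Apex (Old u) (Old v) \<longleftrightarrow> u \<in> V \<and> v = \<sigma> (\<sigma> u) \<and> odd (role u)"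
| "ext1 _ _ _ \<longleftrightarrow> False"

text \<open>Every colour \<open>w\<close> of the frame joins \<open>\<sigma> w\<close> to the point at
  infinity of the half of \<open>\<sigma> w\<close>. This point at infinity can then no longer
  colour an edge at \<open>w\<close>, but the other one can; the opposite points
  \<open>u\<close> and \<open>\<sigma> (\<sigma> u)\<close> have the same unused point at
  infinity, which colours the edge between them. The unused pairs of opposite points serve the
  edges between the apex and the points outside \<open>first_half\<close>, and the unused pair
  of the points at infinity serves the edge from \<open>Inf False\<close> to the apex. Entries
  with the apex do no harm where it is absent, so the same classes work for the orders \<open>4h
  + 2\<close> and \<open>4h + 3\<close>.\<close>

fun ext2 :: "'a ext \<Rightarrow> 'a ext \<Rightarrow> 'a ext \<Rightarrow> bool" where
  "ext2 (Old w) (Old u) (Old v) \<longleftrightarrow> R w u v"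
| "ext2 (Old w) (Old u) (Inf s) \<longleftrightarrow> w \<in> V \<and> u = \<sigma> w \<and> s = side u"
| "ext2 (Old w) (Inf s) (Old u) \<longleftrightarrow> w \<in> V \<and> u = \<sigma> w \<and> s = side u"
| "ext2 (Inf s) (Old u) (Old v) \<longleftrightarrow> u \<in> V \<and> v = \<sigma> (\<sigma> u) \<and> s \<noteq> side (\<sigma> u)"
| "ext2 (Old w) (Old u) Apex \<longleftrightarrow> w \<in> first_half \<and> u = \<sigma> (\<sigma> w)"
| "ext2 (Old w) Apex (Old u) \<longleftrightarrow> w \<in> first_half \<and> u = \<sigma> (\<sigma> w)"
| "ext2 (Inf s) (Inf s') Apex \<longleftrightarrow> s \<and> \<not> s'"
| "ext2 (Inf s) Apex (Inf s') \<longleftrightarrow> s \<and> \<not> s'"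
| "ext2 _ _ _ \<longleftrightarrow> False"

lemma ext1_sym: "ext1 w u v \<Longrightarrow> ext1 w v u"
proof (induction w u v rule: ext1.induct)
  case (4 u v)
  then have "u \<in> V" by simp
  then show ?case using 4 by (cases rule: role_cases) (auto simp: \<sigma>_in \<sigma>4)
qed (auto simp: R_sym)

lemma ext2_sym: "ext2 w u v \<Longrightarrow> ext2 w v u"
  by (induction w u v rule: ext2.induct) (auto simp: R_sym \<sigma>_in \<sigma>4 side_\<sigma>2)

lemma R_free_all:
  assumes "R w u v"
  shows "u \<noteq> \<sigma> w" "u \<noteq> \<sigma> (\<sigma> w)" "u \<noteq> \<sigma> (\<sigma> (\<sigma> w))"
    "w \<noteq> \<sigma> u" "w \<noteq> \<sigma> (\<sigma> u)" "w \<noteq> \<sigma> (\<sigma> (\<sigma> u))"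
proof -
  have V: "w \<in> V" "u \<in> V" using R_in[OF assms] by auto
  show 1: "u \<noteq> \<sigma> w" and 2: "u \<noteq> \<sigma> (\<sigma> w)" and 3: "w \<noteq> \<sigma> u" using R_free[OF assms] by auto
  show "u \<noteq> \<sigma> (\<sigma> (\<sigma> w))" using 3 \<sigma>4[OF V(1)] by auto
  show "w \<noteq> \<sigma> (\<sigma> u)" using 2 \<sigma>4[OF V(2)] by auto
  show "w \<noteq> \<sigma> (\<sigma> (\<sigma> u))" using 1 \<sigma>4[OF V(2)] by auto
qed

lemma ext1_uniq: 
  assumes "ext1 w u v" "ext1 w u v'"
  shows "v = v'"
proof -
  have 1: "\<not> (u = \<sigma> w \<and> u = \<sigma> (\<sigma> (\<sigma> w)))" if "w \<in> V" for w u
    using \<sigma>_neq(2)[of "\<sigma> w"] \<sigma>_in that by auto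
  show ?thesis
    using assms 1 R_uniq
    by (cases w; cases u; cases v; cases v') (auto dest: R_free_all)
qed

text \<open>Where a colour can occur; this is all that matters for clashes.\<close>

lemma ext2_ends:
  "ext2 (Old w) (Old u) v \<Longrightarrow> w \<in> V \<and> (u = \<sigma> w \<or> w \<in> first_half \<and> u = \<sigma> (\<sigma> w) \<or> (\<exists>x. R w u x))"
  "ext2 (Old w) (Inf s) v \<Longrightarrow> w \<in> V \<and> s = side (\<sigma> w)"
  "ext2 (Inf s) (Old u) v \<Longrightarrow> u \<in> V \<and> s \<noteq> side (\<sigma> u)"
  "ext2 (Inf s) (Inf s') v \<Longrightarrow> s \<and> \<not> s'"
  by (cases v; use R_in first_half_in in auto)+

lemma ext2_Apex: "\<not> ext2 Apex u v"
  by (cases u; cases v; simp)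

lemma ext2_uniq_Old:
  assumes "ext2 (Old w) (Old u) v" "ext2 (Old w) (Old u) v'"
  shows "v = v'"
proof -
  have "\<sigma> (\<sigma> w) \<noteq> \<sigma> w" if "w \<in> V"
    using \<sigma>_neq(1)[OF \<sigma>_in[OF that]] .
  then show ?thesis
    using assms first_half_in[of w] by (cases v; cases v') (auto dest: R_free_all R_uniq)
qed

lemma ext2_uniq: "ext2 w u v \<Longrightarrow> ext2 w u v' \<Longrightarrow> v = v'"
proof (induction w u v rule: ext2.induct)
  case (2 w u s)
  then show ?case using ext2_uniq_Old by blast
next
  case (3 w s u)
  then show ?case by (cases v') auto
next
  case (6 w u)
  then show ?case by (cases v') auto
qed (use ext2_uniq_Old in \<open>blast | (cases v'; simp)\<close>)+

lemma ext1_ends: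
  "ext1 (Old w) (Old u) v \<Longrightarrow> w \<in> V \<and> (role w = 0 \<and> u = \<sigma> (\<sigma> w) \<or> role w = 2 \<and> u = \<sigma> w \<or>
     role w = 1 \<and> (u = \<sigma> w \<or> u = \<sigma> (\<sigma> (\<sigma> w))) \<or> (\<exists>x. R w u x))"
  "ext1 (Old w) Apex v \<Longrightarrow> w \<in> V \<and> even (role w)"
  "ext1 Apex (Old u) v \<Longrightarrow> odd (role u)"
  by (cases v; use R_in in auto)+

lemma ext1_Inf: "\<not> ext1 (Inf s) u v" "\<not> ext1 u (Inf s) v" "\<not> ext1 Apex Apex v"
  by (cases u; cases v; simp)+

lemma ext1_anti:
  assumes wu: "ext1 w u v" and uw: "ext1 u w v'"
  shows False
proof (cases w; cases u)
  fix a b assume ab: "w = Old a" "u = Old b"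
  have a: "a \<in> V" "role a = 0 \<and> b = \<sigma> (\<sigma> a) \<or> role a = 2 \<and> b = \<sigma> a \<or>
     role a = 1 \<and> (b = \<sigma> a \<or> b = \<sigma> (\<sigma> (\<sigma> a))) \<or> (\<exists>x. R a b x)"
    and b: "b \<in> V" "role b = 0 \<and> a = \<sigma> (\<sigma> b) \<or> role b = 2 \<and> a = \<sigma> b \<or>
     role b = 1 \<and> (a = \<sigma> b \<or> a = \<sigma> (\<sigma> (\<sigma> b))) \<or> (\<exists>x. R b a x)"
    using ext1_ends(1) wu uw unfolding ab by blast+
  show False
  proof (cases "(\<exists>x. R a b x) \<or> (\<exists>x. R b a x)")
    case True
    then show ?thesis
      using a(2) b(2) R_free_all[of a b] R_free_all[of b a] R_anti[of a b] by blast
  next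
    case False
    have roles: "(role u = 0 \<longrightarrow> role (\<sigma> (\<sigma> u)) = 2) \<and> (role u = 2 \<longrightarrow> role (\<sigma> u) = 3) \<and>
        (role u = 1 \<longrightarrow> role (\<sigma> u) = 2 \<and> role (\<sigma> (\<sigma> (\<sigma> u))) = 0)" if "u \<in> V" for u
      by (rule role_cases[OF that]) simp_all
    from False have "role a = 0 \<and> role b = 2 \<or> role a = 2 \<and> role b = 3 \<or> role a = 1 \<and> (role b = 2 \<or> role b = 0)"
      using a(2) roles[OF a(1)] by metis
    moreover from False have "role b = 0 \<and> role a = 2 \<or> role b = 2 \<and> role a = 3 \<or> role b = 1 \<and> (role a = 2 \<or> role a = 0)"
      using b(2) roles[OF b(1)] by metis
    ultimately show ?thesis by auto
  qed
next
  fix a assume "w = Old a" "u = Apex"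
  then show False using wu uw ext1_ends(2,3) by blast
next
  fix a assume "w = Apex" "u = Old a"
  then show False using wu uw ext1_ends(2,3) by blast
qed (use wu uw ext1_Inf in blast)+

lemma ext2_anti:
  assumes wu: "ext2 w u v" and uw: "ext2 u w v'"
  shows False
proof (cases w; cases u)
  fix a b assume ab: "w = Old a" "u = Old b"
  have a: "a \<in> V" "b = \<sigma> a \<or> a \<in> first_half \<and> b = \<sigma> (\<sigma> a) \<or> (\<exists>x. R a b x)"
    and b: "b \<in> V" "a = \<sigma> b \<or> b \<in> first_half \<and> a = \<sigma> (\<sigma> b) \<or> (\<exists>x. R b a x)"
    using ext2_ends(1) wu uw unfolding ab by blast+
  have "\<sigma> (\<sigma> a) \<noteq> a" "\<sigma> (\<sigma> (\<sigma> a)) \<noteq> a" "\<sigma> (\<sigma> (\<sigma> b)) \<noteq> b"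
    using \<sigma>_neq(2)[OF a(1)] \<sigma>_neq(1)[OF a(1)] \<sigma>_neq(1)[OF b(1)] \<sigma>4[OF a(1)] \<sigma>4[OF b(1)] by auto
  moreover have "\<sigma> (\<sigma> a) \<notin> first_half" if "a \<in> first_half"
    using first_half_opposite[OF a(1)] that by simp
  moreover have "b = \<sigma> a \<or> a \<in> first_half \<and> b = \<sigma> (\<sigma> a)" "a = \<sigma> b \<or> b \<in> first_half \<and> a = \<sigma> (\<sigma> b)"
    using a(2) b(2) R_free_all[of a b] R_free_all[of b a] R_anti[of a b] by blast+
  ultimately show False by metis
next
  fix a s assume "w = Old a" "u = Inf s"
  then show False using wu uw ext2_ends(2,3) by blast
next
  fix a s assume "w = Inf s" "u = Old a"
  then show False using wu uw ext2_ends(2,3) by blast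
next
  fix s s' assume "w = Inf s" "u = Inf s'"
  then show False using wu uw ext2_ends(4) by blast
qed (use wu uw ext2_Apex in blast)+

lemma V_finite_sides:
  "finite (Old ` {u \<in> V. side u = s})" "card (Old ` {u \<in> V. side u = s}) = 2 * h"
  by (simp_all add: fin card_side card_image inj_on_def)

lemma matching_scheme_order_4h_plus_1:
  assumes "h \<noteq> 1"
  shows "\<exists>M. matching_scheme (insert Apex (Old ` V)) (2 * h + 1) (\<noteq>) M"
proof -
  let ?X = "Old ` {u \<in> V. side u = True} :: 'a ext set" and ?Y = "Old ` {u \<in> V. side u = False} :: 'a ext set"
  have "\<exists>S :: nat \<Rightarrow> 'a ext \<Rightarrow> 'a ext \<Rightarrow> bool.
     (\<forall>c u v. S c u v \<longrightarrow> S c v u) \<and> (\<forall>c u v v'. S c u v \<longrightarrow> S c u v' \<longrightarrow> v = v') \<and>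
     (\<forall>u\<in>?X. \<forall>v\<in>?Y. \<exists>c<2 * h + 1. S c u v) \<and> (\<forall>p\<in>Old ` first_half. \<exists>c<2 * h + 1. S c p Apex)"
  proof (rule bipartite_apex_matchings)
    show "finite ?X" "finite ?Y" "card ?X = 2 * h" "card ?Y = 2 * h"
      by (rule V_finite_sides)+
    show "?X \<inter> ?Y = {}" "Old ` first_half \<subseteq> ?X \<union> ?Y" "Apex \<notin> ?X \<union> ?Y"
      by (auto simp: first_half_def)
    show "card (Old ` first_half) = 2 * h" by (simp add: card_first_half card_image inj_on_def)
    show "2 * h \<noteq> 2" using assms by simp
  qed
  then obtain S :: "nat \<Rightarrow> 'a ext \<Rightarrow> 'a ext \<Rightarrow> bool" where
     S_sym: "\<forall>c u v. S c u v \<longrightarrow> S c v u" and S_uniq: "\<forall>c u v v'. S c u v \<longrightarrow> S c u v' \<longrightarrow> v = v'"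
     and S_XY': "\<forall>u\<in>?X. \<forall>v\<in>?Y. \<exists>c<2 * h + 1. S c u v"
     and S_P': "\<forall>p\<in>Old ` first_half. \<exists>c<2 * h + 1. S c p Apex"
    by (elim exE conjE) (rule that)
  have S_XY: "\<exists>c<2 * h + 1. S c (Old u) (Old v)" if "u \<in> V" "v \<in> V" "side u" "\<not> side v" for u v
    using S_XY' that by auto
  have S_P: "\<exists>c<2 * h + 1. S c (Old p) Apex" if "p \<in> first_half" for p
    using S_P' that by auto
  let ?cov = "\<lambda>u v. (\<exists>w\<in>insert Apex (Old ` V). ext1 w u v) \<or> (\<exists>b<2 * h + 1. S b u v)"
  have cov_sym: "?cov u v" if "?cov v u" for u v
    using that ext1_sym S_sym by blast
  have apex: "?cov (Old u) Apex" if u: "u \<in> V" for u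
  proof (rule role_cases[OF u])
    assume "role u = 2" "role (\<sigma> (\<sigma> u)) = 0"
    then have "ext1 (Old (\<sigma> (\<sigma> u))) (Old u) Apex" using u by (simp add: \<sigma>_in \<sigma>4)
    then show ?thesis using u \<sigma>_in by blast
  next
    assume "role u = 3" "role (\<sigma> (\<sigma> (\<sigma> u))) = 2"
    then have "ext1 (Old (\<sigma> (\<sigma> (\<sigma> u)))) (Old u) Apex" using u by (simp add: \<sigma>_in \<sigma>4)
    then show ?thesis using u \<sigma>_in by blast
  qed (use u S_P[of u] in \<open>auto simp: first_half_def\<close>)
  \<comment> \<open>If the role of \<open>u\<close> is even, the point of role 1 lies halfway between \<open>u\<close> and its opposite,
    on one side or the other.\<close>
  have opp: "?cov (Old u) (Old (\<sigma> (\<sigma> u)))" if u: "u \<in> V" for u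
  proof (cases "odd (role u)")
    case True
    then have "ext1 Apex (Old u) (Old (\<sigma> (\<sigma> u)))" using u by simp
    then show ?thesis by blast
  next
    case False
    show ?thesis
    proof (rule role_cases[OF u])
      assume "role (\<sigma> u) = 1"
      then have "ext1 (Old (\<sigma> u)) (Old u) (Old (\<sigma> (\<sigma> u)))" using u by (simp add: \<sigma>_in \<sigma>4)
      then show ?thesis using u \<sigma>_in by blast
    next
      assume "role (\<sigma> (\<sigma> (\<sigma> u))) = 1"
      then have "ext1 (Old (\<sigma> (\<sigma> (\<sigma> u)))) (Old u) (Old (\<sigma> (\<sigma> u)))" using u by (simp add: \<sigma>_in \<sigma>4)
      then show ?thesis using u \<sigma>_in by blast
    qed (use False in auto)
  qed
  have old: "?cov (Old u) (Old v)" if uv: "u \<in> V" "v \<in> V" "u \<noteq> v" for u v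
  proof -
    consider "v = \<sigma> (\<sigma> u)" | "side u = side v" "v \<noteq> \<sigma> (\<sigma> u)"
      | "side u" "\<not> side v" | "\<not> side u" "side v" by blast
    then show ?thesis
    proof cases
      case 2
      then obtain w where "R w u v" using R_cover uv by blast
      then have "ext1 (Old w) (Old u) (Old v)" "w \<in> V" using R_in by auto
      then show ?thesis by blast
    next
      case 1 then show ?thesis using opp uv by simp
    next
      case 3 then show ?thesis using S_XY uv by blast
    next
      case 4 then show ?thesis using S_XY[of v u] uv S_sym by blast
    qed
  qed
  have "matching_scheme (insert Apex (Old ` V)) (2 * h + 1) (\<noteq>) (case_sum ext1 S)"
    using ext1_sym ext1_uniq ext1_anti S_sym S_uniq
  proof (rule matching_scheme_combine)
    fix u v :: "'a ext"
    assume "u \<in> insert Apex (Old ` V)" "v \<in> insert Apex (Old ` V)" "u \<noteq> v"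
    then show "?cov u v" using apex old cov_sym by blast
  qed
  then show ?thesis by blast
qed

definition part :: "bool \<Rightarrow> 'a ext set" where
  "part s = insert (Inf s) (Old ` {u \<in> V. side u = s})"

lemma part_sides: "finite (part s)" "card (part s) = 2 * h + 1" "part True \<inter> part False = {}"
  using V_finite_sides[of s] by (auto simp: part_def card_insert_if)

lemma card_part: "card (part True \<union> part False) = 4 * h + 2"
  using part_sides by (simp add: card_Un_disjoint)

lemma ext2_cover:
  assumes "u \<in> part s" "v \<in> part s" "u \<noteq> v"
  shows "\<exists>w \<in> part True \<union> part False. ext2 w u v"
proof -
  have Old_X: "Old w \<in> part True \<union> part False" if "w \<in> V" for w
    using that by (auto simp: part_def)
  have Inf: "\<exists>w \<in> part True \<union> part False. ext2 w (Old a) (Inf s)" if a: "a \<in> V" "side a = s" for a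
    using a Old_X[of "\<sigma> (\<sigma> (\<sigma> a))"] by (intro bexI[of _ "Old (\<sigma> (\<sigma> (\<sigma> a)))"]) (simp_all add: \<sigma>_in \<sigma>4)
  have Old: "\<exists>w \<in> part True \<union> part False. ext2 w (Old a) (Old b)"
    if ab: "a \<in> V" "b \<in> V" "side a = side b" "a \<noteq> b" for a b
  proof (cases "b = \<sigma> (\<sigma> a)")
    case True
    then have "ext2 (Inf (\<not> side (\<sigma> a))) (Old a) (Old b)" using ab by simp
    moreover have "Inf t \<in> part True \<union> part False" for t by (cases t) (auto simp: part_def)
    ultimately show ?thesis by blast
  next
    case False
    then obtain w where w: "R w a b" using R_cover ab by blast
    then have "ext2 (Old w) (Old a) (Old b)" by simp
    then show ?thesis using Old_X w R_in by blast
  qed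
  consider a b where "u = Old a" "v = Old b" "a \<in> V" "b \<in> V" "side a = side b" "a \<noteq> b"
    | a where "u = Old a" "v = Inf s" "a \<in> V" "side a = s"
    | a where "u = Inf s" "v = Old a" "a \<in> V" "side a = s"
    using assms by (auto simp: part_def)
  then show ?thesis
  proof cases
    case 1 then show ?thesis using Old by simp
  next
    case 2 then show ?thesis using Inf by simp
  next
    case 3 then show ?thesis using Inf ext2_sym by blast
  qed
qed

lemma matching_scheme_order_4h_plus_2:
  "\<exists>M. matching_scheme (part True \<union> part False) (2 * h + 1) (\<noteq>) M"
proof -
  obtain S :: "nat \<Rightarrow> 'a ext \<Rightarrow> 'a ext \<Rightarrow> bool" where
     S_sym: "\<forall>c u v. S c u v \<longrightarrow> S c v u" and S_uniq: "\<forall>c u v v'. S c u v \<longrightarrow> S c u v' \<longrightarrow> v = v'"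
     and S_X: "\<forall>u\<in>part True. \<forall>v\<in>part False. \<exists>c<2 * h + 1. S c u v"
    using bipartite_matchings[OF part_sides(1) part_sides(1) part_sides(3) part_sides(2) part_sides(2)] by metis
  have "matching_scheme (part True \<union> part False) (2 * h + 1) (\<noteq>) (case_sum ext2 S)"
    using ext2_sym ext2_uniq ext2_anti S_sym S_uniq
  proof (rule matching_scheme_combine)
    fix u v assume "u \<in> part True \<union> part False" "v \<in> part True \<union> part False" "u \<noteq> v"
    then show "(\<exists>w \<in> part True \<union> part False. ext2 w u v) \<or> (\<exists>b<2 * h + 1. S b u v)"
      using ext2_cover S_X S_sym by (metis UnE)
  qed
  then show ?thesis by blast
qed

lemma matching_scheme_order_4h_plus_3:
  "\<exists>M. matching_scheme (insert Apex (part True \<union> part False)) (2 * h + 2) (\<noteq>) M"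
proof -
  \<comment> \<open>\<open>first_half\<close> falls short of half of the \<open>4 * h + 2\<close> vertices by one.\<close>
  let ?P = "insert (Inf True) (Old ` first_half)"
  have "\<exists>S :: nat \<Rightarrow> 'a ext \<Rightarrow> 'a ext \<Rightarrow> bool.
     (\<forall>c u v. S c u v \<longrightarrow> S c v u) \<and> (\<forall>c u v v'. S c u v \<longrightarrow> S c u v' \<longrightarrow> v = v') \<and>
     (\<forall>u\<in>part True. \<forall>v\<in>part False. \<exists>c<2 * h + 1 + 1. S c u v) \<and> (\<forall>p\<in>?P. \<exists>c<2 * h + 1 + 1. S c p Apex)"
  proof (rule bipartite_apex_matchings)
    show "finite (part True)" "finite (part False)" "part True \<inter> part False = {}"
      "card (part True) = 2 * h + 1" "card (part False) = 2 * h + 1"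
      using part_sides by auto
    show "?P \<subseteq> part True \<union> part False" "Apex \<notin> part True \<union> part False"
      by (auto simp: part_def first_half_def)
    have "finite first_half" using fin by (simp add: first_half_def)
    moreover have "Inf True \<notin> Old ` first_half" by auto
    ultimately show "card ?P = 2 * h + 1" by (simp add: card_first_half card_image inj_on_def)
    show "2 * h + 1 \<noteq> 2" by presburger
  qed
  then obtain S :: "nat \<Rightarrow> 'a ext \<Rightarrow> 'a ext \<Rightarrow> bool" where
     S_sym: "\<forall>c u v. S c u v \<longrightarrow> S c v u" and S_uniq: "\<forall>c u v v'. S c u v \<longrightarrow> S c u v' \<longrightarrow> v = v'"
     and S_X: "\<forall>u\<in>part True. \<forall>v\<in>part False. \<exists>c<2 * h + 2. S c u v"
     and S_P: "\<forall>p\<in>?P. \<exists>c<2 * h + 2. S c p Apex"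
    unfolding add.assoc one_add_one by (elim exE conjE) (rule that)
  let ?cov = "\<lambda>u v. (\<exists>w\<in>insert Apex (part True \<union> part False). ext2 w u v) \<or> (\<exists>b<2 * h + 2. S b u v)"
  have cov_sym: "?cov u v" if "?cov v u" for u v
    using that ext2_sym S_sym by blast
  have part: "?cov u v" if "u \<in> part True \<union> part False" "v \<in> part True \<union> part False" "u \<noteq> v" for u v
    using that ext2_cover S_X S_sym by (metis UnE insertCI)
  have Apex: "?cov u Apex" if u: "u \<in> part True \<union> part False" for u
  proof (cases "u \<in> ?P")
    case False
    then consider "u = Inf False" | a where "u = Old a" "a \<in> V" "a \<notin> first_half"
      using u by (auto simp: part_def)
    then show ?thesis
    proof cases
      case 1
      then have "ext2 (Inf True) u Apex" "Inf True \<in> part True" by (simp_all add: part_def)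
      then show ?thesis by blast
    next
      case 2
      then have "ext2 (Old (\<sigma> (\<sigma> a))) u Apex" by (simp add: first_half_opposite \<sigma>4)
      moreover have "Old (\<sigma> (\<sigma> a)) \<in> part True \<union> part False" using 2 \<sigma>_in by (auto simp: part_def)
      ultimately show ?thesis by blast
    qed
  qed (use S_P in blast)
  have "matching_scheme (insert Apex (part True \<union> part False)) (2 * h + 2) (\<noteq>) (case_sum ext2 S)"
    using ext2_sym ext2_uniq ext2_anti S_sym S_uniq
  proof (rule matching_scheme_combine)
    fix u v assume "u \<in> insert Apex (part True \<union> part False)" "v \<in> insert Apex (part True \<union> part False)" "u \<noteq> v"
    then consider "u \<in> part True \<union> part False" "v \<in> part True \<union> part False" | "u = Apex" "v \<in> part True \<union> part False"
      | "u \<in> part True \<union> part False" "v = Apex"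
      by blast
    then show "?cov u v"
    proof cases
      case 1 then show ?thesis using part \<open>u \<noteq> v\<close> by blast
    next
      case 2 then show ?thesis using Apex[OF 2(2)] cov_sym by blast
    next
      case 3 then show ?thesis using Apex[OF 3(1)] by blast
    qed
  qed
  then show ?thesis by blast
qed

end

section \<open>A cyclic frame on 4h points\<close>

text \<open>The residues of \<open>u - w\<close> and \<open>w + a\<close> modulo \<open>r\<close>, for
  arguments that are reduced already. Avoiding \<open>mod\<close> keeps the proofs within linear
  arithmetic.\<close>

definition offset :: "int \<Rightarrow> int \<Rightarrow> int \<Rightarrow> int" where
  "offset r w u = (if w \<le> u then u - w else u - w + r)"

definition shift :: "int \<Rightarrow> int \<Rightarrow> int \<Rightarrow> int" where
  "shift r w a = (if w + a < r then w + a else w + a - r)"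

text \<open>The offsets from \<open>w\<close> range over the interval from \<open>lo\<close> to \<open>m -
  lo\<close> and are reflected in its midpoint; if \<open>m\<close> is even, the midpoint
  remains unmatched.\<close>

definition reflect :: "int \<Rightarrow> int \<Rightarrow> int \<Rightarrow> int \<Rightarrow> int \<Rightarrow> int \<Rightarrow> bool" where
  "reflect r lo m w u v \<longleftrightarrow>
     w \<in> {0..<r} \<and> u \<in> {0..<r} \<and> v \<in> {0..<r} \<and> u \<noteq> v \<and>
     lo \<le> offset r w u \<and> lo \<le> offset r w v \<and> offset r w u + offset r w v = m"

lemma reflect_sym: "reflect r lo m w u v \<Longrightarrow> reflect r lo m w v u"
  by (auto simp: reflect_def)

lemma reflect_uniq: "reflect r lo m w u v \<Longrightarrow> reflect r lo m w u v' \<Longrightarrow> v = v'"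
  by (auto simp: reflect_def offset_def split: if_splits)

text \<open>The offsets \<open>(m - d) / 2\<close> and \<open>(m + d) / 2\<close> have the difference
  \<open>d\<close> and the sum \<open>m\<close>.\<close>

lemma reflect_cover:
  assumes "u \<in> {0..<r}" "v \<in> {0..<r}" "u \<noteq> v" "0 \<le> lo" "m - lo < r"
    and "offset r u v \<le> m - 2 * lo" "even (m - offset r u v)"
  shows "\<exists>w. reflect r lo m w u v"
proof -
  define a where "a = (m - offset r u v) div 2"
  have a: "2 * a + offset r u v = m" using assms(7) by (auto simp: a_def)
  show ?thesis
  proof (cases "a \<le> u")
    case True
    then have "reflect r lo m (u - a) u v"
      using a assms by (auto simp: reflect_def offset_def split: if_splits)
    then show ?thesis ..
  next
    case False
    then have "reflect r lo m (u - a + r) u v"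
      using a assms by (auto simp: reflect_def offset_def split: if_splits)
    then show ?thesis ..
  qed
qed

definition points :: "int \<Rightarrow> (bool \<times> int) set" where
  "points r = UNIV \<times> {0..<r}"

lemma card_points_side: "card {u \<in> points r. fst u = s} = nat r"
proof -
  have "{u \<in> points r. fst u = s} = {s} \<times> {0..<r}" by (auto simp: points_def)
  then show ?thesis by (simp add: card_cartesian_product)
qed

lemma finite_points: "finite (points r)"
  by (simp add: points_def)

text \<open>A colour occurs in its own half at the offsets \<open>1, \<dots>, h - 1\<close>, colours of
  the half \<open>False\<close> occur in the half \<open>True\<close> at \<open>0, \<dots>, h -
  1\<close>, and colours of \<open>True\<close> in \<open>False\<close> at \<open>1, \<dots>,
  h\<close>. Modulo \<open>2h\<close>, the first set is disjoint from its negative and the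
  second from the negative of the third, so there are no clashes. The offset sums are
  \<open>h\<close> and \<open>h \<plusminus> 1\<close>, so in each half the differences of both
  parities occur.\<close>

definition rotational :: "int \<Rightarrow> bool \<times> int \<Rightarrow> bool \<times> int \<Rightarrow> bool \<times> int \<Rightarrow> bool" where
  "rotational h w u v \<longleftrightarrow> fst u = fst v \<and>
     (if fst w = fst u then reflect (2 * h) 1 h (snd w) (snd u) (snd v)
      else if fst u then reflect (2 * h) 0 (h - 1) (snd w) (snd u) (snd v)
      else reflect (2 * h) 1 (h + 1) (snd w) (snd u) (snd v))"

lemma rotational_in: "rotational h w u v \<Longrightarrow> w \<in> points (2 * h) \<and> u \<in> points (2 * h) \<and> v \<in> points (2 * h)"
  by (cases w; cases u; cases v) (auto simp: rotational_def points_def reflect_def split: if_splits)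

lemma rotational_sym: "rotational h w u v \<Longrightarrow> rotational h w v u"
  by (auto simp: rotational_def intro: reflect_sym)

lemma rotational_uniq: "rotational h w u v \<Longrightarrow> rotational h w u v' \<Longrightarrow> v = v'"
  by (cases v; cases v') (auto simp: rotational_def split: if_splits dest: reflect_uniq)

lemma rotational_anti: "rotational h w u v \<Longrightarrow> \<not> rotational h u w v'"
  by (auto simp: rotational_def reflect_def offset_def split: if_splits)

lemma rotational_cover:
  assumes u: "u \<in> points (2 * h)" and v: "v \<in> points (2 * h)" and ne: "u \<noteq> v"
    and side: "fst u = fst v" and nopp: "snd v \<noteq> shift (2 * h) (snd u) h"
  shows "\<exists>w. rotational h w u v"
proof -
  have *: "\<exists>w. rotational h w (s, i) (s, j)"
    if ij: "i \<in> {0..<2 * h}" "j \<in> {0..<2 * h}" "i \<noteq> j" and d: "offset (2 * h) i j < h" for s i j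
  proof (cases "even (h - offset (2 * h) i j)")
    case True
    then have "offset (2 * h) i j \<le> h - 2 * 1" using d by presburger
    then obtain w where "reflect (2 * h) 1 h w i j"
      using reflect_cover[OF ij, of 1 h] True ij by auto
    then have "rotational h (s, w) (s, i) (s, j)" by (simp add: rotational_def)
    then show ?thesis ..
  next
    case False
    show ?thesis
    proof (cases s)
      case True
      obtain w where "reflect (2 * h) 0 (h - 1) w i j"
        using reflect_cover[OF ij, of 0 "h - 1"] False d ij by auto
      then have "rotational h (False, w) (s, i) (s, j)" using True by (simp add: rotational_def)
      then show ?thesis ..
    next
      case s: False
      obtain w where "reflect (2 * h) 1 (h + 1) w i j"
        using reflect_cover[OF ij, of 1 "h + 1"] False d ij by auto
      then have "rotational h (True, w) (s, i) (s, j)" using s by (simp add: rotational_def)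
      then show ?thesis ..
    qed
  qed
  obtain s i j where uv: "u = (s, i)" "v = (s, j)" using side by (cases u; cases v) auto
  have ij: "i \<in> {0..<2 * h}" "j \<in> {0..<2 * h}" "i \<noteq> j" using u v ne uv by (auto simp: points_def)
  have "offset (2 * h) i j < h \<or> offset (2 * h) j i < h"
    using ij nopp uv by (auto simp: offset_def shift_def split: if_splits)
  then show ?thesis using *[OF ij, of s] *[OF ij(2,1), of s] ij(3) uv rotational_sym by blast
qed

text \<open>Takes \<open>w\<close> to the midpoint that \<open>rotational h w\<close> leaves unmatched. It
  lies in the half where the offset sum is even: the half of \<open>w\<close> itself if
  \<open>h\<close> is even, the other one if \<open>h\<close> is odd.\<close>

definition quarter_turn :: "int \<Rightarrow> bool \<times> int \<Rightarrow> bool \<times> int" where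
  "quarter_turn h u =
     (if even h then (fst u, shift (2 * h) (snd u) (h div 2))
      else (\<not> fst u, shift (2 * h) (snd u) (if fst u then (h + 1) div 2 else (h - 1) div 2)))"

definition quarter :: "int \<Rightarrow> bool \<times> int \<Rightarrow> nat" where
  "quarter h u =
     (if even h then
        if snd u < h div 2 then 0 else if snd u < h then 1 else if snd u < h + h div 2 then 2 else 3
      else if fst u then if snd u < h then 0 else 2
      else if offset (2 * h) ((h + 1) div 2) (snd u) < h then 1 else 3)"

text \<open>In the odd case the two offsets \<open>(h + 1) / 2\<close> and \<open>(h - 1) / 2\<close> add
  up to \<open>h\<close>.\<close>

lemma quarter_turn_twice:
  assumes "u \<in> points (2 * h)"
  shows "quarter_turn h (quarter_turn h u) = (fst u, shift (2 * h) (snd u) h)"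
proof (cases "even h")
  case True
  then obtain g where "h = 2 * g" by blast
  then show ?thesis using assms by (cases u) (auto simp: quarter_turn_def shift_def points_def)
next
  case False
  then obtain g where "h = 2 * g + 1" by (rule oddE)
  then show ?thesis using assms by (cases u) (auto simp: quarter_turn_def shift_def points_def)
qed

lemma quarter_turn_in: "u \<in> points (2 * h) \<Longrightarrow> quarter_turn h u \<in> points (2 * h)"
  by (cases u) (auto simp: quarter_turn_def shift_def points_def)

lemma quartered_frame_rotational:
  "quartered_frame (points (2 * int h)) h fst (rotational (int h)) (quarter_turn (int h)) (quarter (int h))"
proof
  show "finite (points (2 * int h))" by (rule finite_points)
  show "card {u \<in> points (2 * int h). fst u = s} = 2 * h" for s
    by (simp add: card_points_side nat_mult_distrib)
  fix u assume u: "u \<in> points (2 * int h)"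
  show "quarter (int h) u < 4" by (simp add: quarter_def)
  show "quarter (int h) (quarter_turn (int h) u) = (quarter (int h) u + 1) mod 4"
  proof (cases "even (int h)")
    case True
    then obtain g where "int h = 2 * g" by blast
    then show ?thesis using u
      by (cases u) (auto simp: quarter_def quarter_turn_def shift_def points_def offset_def)
  next
    case False
    then obtain g where "int h = 2 * g + 1" by (rule oddE)
    then show ?thesis using u
      by (cases u) (auto simp: quarter_def quarter_turn_def shift_def points_def offset_def)
  qed
  show in2: "quarter_turn (int h) u \<in> points (2 * int h)" using u by (rule quarter_turn_in)
  show "fst (quarter_turn (int h) (quarter_turn (int h) u)) = fst u"
    using quarter_turn_twice[OF u] by simp
  show "quarter_turn (int h) (quarter_turn (int h) (quarter_turn (int h) (quarter_turn (int h) u))) = u"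
    using quarter_turn_twice[OF u] quarter_turn_twice[OF quarter_turn_in[OF quarter_turn_in[OF u]]] u
    by (cases u) (auto simp: shift_def points_def)
next
  fix w u v assume R: "rotational (int h) w u v"
  have in_points: "w \<in> points (2 * int h)" "u \<in> points (2 * int h)" using rotational_in[OF R] by auto
  have "u \<noteq> quarter_turn (int h) w \<and> w \<noteq> quarter_turn (int h) u"
  proof (cases "even (int h)")
    case True
    then obtain g where "int h = 2 * g" by blast
    then show ?thesis using R
      by (cases w; cases u; cases v)
        (auto simp: rotational_def reflect_def quarter_turn_def offset_def shift_def split: if_splits)
  next
    case False
    then obtain g where "int h = 2 * g + 1" by (rule oddE)
    then show ?thesis using R
      by (cases w; cases u; cases v)
        (auto simp: rotational_def reflect_def quarter_turn_def offset_def shift_def split: if_splits)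
  qed
  moreover have "u \<noteq> quarter_turn (int h) (quarter_turn (int h) w)"
    using R unfolding quarter_turn_twice[OF in_points(1)]
    by (cases w; cases u; cases v) (auto simp: rotational_def reflect_def offset_def shift_def split: if_splits)
  ultimately show "u \<noteq> quarter_turn (int h) w \<and> w \<noteq> quarter_turn (int h) u \<and>
      u \<noteq> quarter_turn (int h) (quarter_turn (int h) w)" by blast
next
  fix u v assume "u \<in> points (2 * int h)" "v \<in> points (2 * int h)" "u \<noteq> v" "fst u = fst v"
    "v \<noteq> quarter_turn (int h) (quarter_turn (int h) u)"
  then show "\<exists>w. rotational (int h) w u v"
    by (intro rotational_cover) (auto simp: quarter_turn_twice prod_eq_iff)
qed (use rotational_in rotational_sym rotational_uniq rotational_anti in blast)+

section \<open>Order 4k + 4 from a frame on 4k + 2 points\<close>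

text \<open>\<open>core w\<close> is the class of the colour \<open>w\<close> on the \<open>4k + 2\<close>
  points. A point \<open>w\<close> of the half \<open>False\<close> and the point at the offset
  \<open>d s\<close> from it in the half \<open>s\<close> form an unused pair; it will serve an
  edge to the point at infinity \<open>Inf s\<close>. The edges of the half \<open>True\<close>
  whose ends differ by \<open>k\<close> or \<open>k + 1\<close> form a Hamiltonian cycle; of
  these, \<open>core\<close> has to cover the single edge from 0 to \<open>k\<close>.\<close>

locale split_frame =
  fixes k :: nat and core :: "bool \<times> int \<Rightarrow> bool \<times> int \<Rightarrow> bool \<times> int \<Rightarrow> bool" and d :: "bool \<Rightarrow> int"
  assumes core_in: "core w u v \<Longrightarrow> w \<in> points (2 * int k + 1) \<and> u \<in> points (2 * int k + 1) \<and> v \<in> points (2 * int k + 1)"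
    and core_sym: "core w u v \<Longrightarrow> core w v u"
    and core_uniq: "core w u v \<Longrightarrow> core w u v' \<Longrightarrow> v = v'"
    and core_anti: "core w u v \<Longrightarrow> \<not> core u w v'"
    and core_free: "\<not> fst w \<Longrightarrow> offset (2 * int k + 1) (snd w) (snd u) = d (fst u) \<Longrightarrow> \<not> core w u v \<and> \<not> core u w v"
    and core_cover: "u \<in> points (2 * int k + 1) \<Longrightarrow> v \<in> points (2 * int k + 1) \<Longrightarrow> fst u = fst v \<Longrightarrow> u \<noteq> v \<Longrightarrow>
       (fst u \<longrightarrow> \<bar>snd u - snd v\<bar> \<notin> {int k, int k + 1}) \<Longrightarrow> \<exists>w. core w u v"
    and core_cover_edge: "\<exists>w. core w (True, 0) (True, int k)"
    and d_bounds: "0 \<le> d s" "d s \<le> 2 * int k" "d False \<noteq> 0"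
begin

abbreviation r :: int where "r \<equiv> 2 * int k + 1"

definition pendant :: "bool \<times> int \<Rightarrow> bool \<times> int \<Rightarrow> bool \<Rightarrow> bool" where
  "pendant w u s \<longleftrightarrow> w \<in> points r \<and> u \<in> points r \<and> \<not> fst w \<and> fst u = s \<and> offset r (snd w) (snd u) = d s"

text \<open>The Hamiltonian cycle without the edge from 0 to \<open>k\<close> is a path, and its edges
  alternate between these two matchings.\<close>

definition path_edge :: "bool \<Rightarrow> bool \<times> int \<Rightarrow> bool \<times> int \<Rightarrow> bool" where
  "path_edge s u v \<longleftrightarrow> fst u \<and> fst v \<and>
     (if s then 1 \<le> snd u \<and> snd u \<le> int k \<and> snd v = snd u + int k
      else 0 \<le> snd u \<and> snd u < int k \<and> snd v = snd u + int k + 1)"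

text \<open>Colours of the half \<open>False\<close> join the points at infinity to all points, so the
  points at infinity can only colour edges in the half \<open>True\<close>. They share the path
  there.\<close>

fun split_colour :: "(bool \<times> int) ext \<Rightarrow> (bool \<times> int) ext \<Rightarrow> (bool \<times> int) ext \<Rightarrow> bool" where
  "split_colour (Old w) (Old u) (Old v) \<longleftrightarrow> core w u v"
| "split_colour (Old w) (Old u) (Inf s) \<longleftrightarrow> pendant w u s"
| "split_colour (Old w) (Inf s) (Old u) \<longleftrightarrow> pendant w u s"
| "split_colour (Inf s) (Old u) (Old v) \<longleftrightarrow> path_edge s u v \<or> path_edge s v u"
| "split_colour _ _ _ \<longleftrightarrow> False"

lemma split_colour_sym: "split_colour w u v \<Longrightarrow> split_colour w v u"
  by (induction w u v rule: split_colour.induct) (auto simp: core_sym)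

lemma split_colour_ends:
  "split_colour (Old w) (Old u) v \<Longrightarrow> (\<exists>x. core w u x) \<or> (\<exists>s. pendant w u s)"
  "split_colour (Old w) (Inf s) v \<Longrightarrow> \<not> fst w"
  "split_colour (Inf s) (Old u) v \<Longrightarrow> fst u"
  by (cases v; auto simp: pendant_def path_edge_def)+

lemma split_colour_none: "\<not> split_colour Apex u v" "\<not> split_colour u Apex v" "\<not> split_colour (Inf s) (Inf s') v"
  by (cases u; cases v; simp)+

lemma pendant_side: "pendant w u s \<Longrightarrow> fst u = s"
  by (simp add: pendant_def)

lemma pendant_uniq: "pendant w u s \<Longrightarrow> pendant w u' s \<Longrightarrow> u = u'"
  by (cases u; cases u') (auto simp: pendant_def offset_def points_def split: if_splits)

lemma core_pendant: "pendant w u s \<Longrightarrow> \<not> core w u v" "pendant w u s \<Longrightarrow> \<not> core u w v"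
  using core_free by (auto simp: pendant_def)

lemma pendant_anti: "pendant w u s \<Longrightarrow> \<not> pendant u w s'"
  using d_bounds(3) by (cases u; cases w) (auto simp: pendant_def offset_def points_def split: if_splits, presburger+)

lemma path_edge_uniq:
  "path_edge s u v \<or> path_edge s v u \<Longrightarrow> path_edge s u v' \<or> path_edge s v' u \<Longrightarrow> v = v'"
  by (cases u; cases v; cases v') (auto simp: path_edge_def split: if_splits)

lemma split_colour_uniq_Old: "split_colour (Old w) (Old u) v \<Longrightarrow> split_colour (Old w) (Old u) v' \<Longrightarrow> v = v'"
  by (cases v; cases v') (auto dest: core_uniq core_pendant pendant_side)

lemma split_colour_uniq: "split_colour w u v \<Longrightarrow> split_colour w u v' \<Longrightarrow> v = v'"
proof (induction w u v rule: split_colour.induct)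
  case (3 w s u)
  then show ?case by (cases v') (auto dest: pendant_uniq)
next
  case (4 s u v)
  then obtain x where x: "v' = Old x" "path_edge s u x \<or> path_edge s x u"
    by (cases v') simp_all
  then have "v = x" using 4(1) path_edge_uniq[of s u v x] unfolding split_colour.simps by blast
  then show ?case using x by simp
qed (use split_colour_uniq_Old in \<open>blast | simp\<close>)+

lemma split_colour_anti:
  assumes wu: "split_colour w u v" and uw: "split_colour u w v'"
  shows False
proof (cases w; cases u)
  fix a b assume "w = Old a" "u = Old b"
  then have "(\<exists>x. core a b x) \<or> (\<exists>s. pendant a b s)" "(\<exists>x. core b a x) \<or> (\<exists>s. pendant b a s)"
    using wu uw split_colour_ends(1) by blast+
  then show False using core_anti core_pendant pendant_anti by blast
next
  fix a s assume "w = Old a" "u = Inf s"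
  then show False using wu uw split_colour_ends(2,3) by blast
next
  fix a s assume "w = Inf s" "u = Old a"
  then show False using wu uw split_colour_ends(2,3) by blast
qed (use wu uw split_colour_none in blast)+

definition part :: "bool \<Rightarrow> (bool \<times> int) ext set" where
  "part s = insert (Inf s) (Old ` {u \<in> points r. fst u = s})"

lemma part_sides: "finite (part s)" "card (part s) = 2 * k + 2" "part True \<inter> part False = {}"
proof -
  have fin: "finite {u \<in> points r. fst u = s}" using finite_points by simp
  show "finite (part s)" "part True \<inter> part False = {}" using fin by (auto simp: part_def)
  have "card (Old ` {u \<in> points r. fst u = s}) = 2 * k + 1"
    by (simp add: card_image inj_on_def card_points_side nat_add_distrib nat_mult_distrib)
  moreover have "Inf s \<notin> Old ` {u \<in> points r. fst u = s}" by auto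
  ultimately show "card (part s) = 2 * k + 2" using fin by (simp add: part_def)
qed

lemma card_part: "card (part True \<union> part False) = 4 * k + 4"
  using part_sides by (simp add: card_Un_disjoint)

lemma split_colour_cover:
  assumes "u \<in> part s" "v \<in> part s" "u \<noteq> v"
  shows "\<exists>w \<in> part True \<union> part False. split_colour w u v"
proof -
  have Old_X: "Old w \<in> part True \<union> part False" if "w \<in> points r" for w
    using that by (auto simp: part_def)
  have Inf: "\<exists>w \<in> part True \<union> part False. split_colour w (Old a) (Inf s)" if a: "a \<in> points r" "fst a = s" for a
  proof -
    let ?w = "(False, offset r (d s) (snd a))"
    have pendant: "pendant ?w a s"
      using a d_bounds(1,2)[of s] by (cases a) (auto simp: pendant_def offset_def points_def)
    then have "split_colour (Old ?w) (Old a) (Inf s)" by simp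
    moreover have "Old ?w \<in> part True \<union> part False" using pendant by (intro Old_X) (simp add: pendant_def)
    ultimately show ?thesis by blast
  qed
  have path: "\<exists>w \<in> part True \<union> part False. split_colour w (Old (True, i)) (Old (True, j))"
    if ij: "0 \<le> i" "j \<le> 2 * int k" "j = i + int k \<or> j = i + int k + 1" for i j
  proof (cases "i = 0 \<and> j = int k")
    case True
    then obtain w where w: "core w (True, i) (True, j)" using core_cover_edge by auto
    then have "split_colour (Old w) (Old (True, i)) (Old (True, j))" by simp
    then show ?thesis using Old_X w core_in by blast
  next
    case False
    then have "split_colour (Inf (j = i + int k)) (Old (True, i)) (Old (True, j))"
      using ij by (auto simp: path_edge_def)
    moreover have "Inf t \<in> part True \<union> part False" for t by (cases t) (auto simp: part_def)
    ultimately show ?thesis by blast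
  qed
  have Old: "\<exists>w \<in> part True \<union> part False. split_colour w (Old a) (Old b)"
    if ab: "a \<in> points r" "b \<in> points r" "fst a = fst b" "a \<noteq> b" for a b
  proof (cases "fst a \<and> \<bar>snd a - snd b\<bar> \<in> {int k, int k + 1}")
    case True
    then obtain i j where ij: "a = (True, i)" "b = (True, j)" using ab(3) by (cases a; cases b) auto
    then have "j = i + int k \<or> j = i + int k + 1 \<or> i = j + int k \<or> i = j + int k + 1"
      using True by auto
    moreover have "0 \<le> i" "i \<le> 2 * int k" "0 \<le> j" "j \<le> 2 * int k"
      using ab ij by (auto simp: points_def)
    ultimately show ?thesis unfolding ij using path[of i j] path[of j i] split_colour_sym by blast
  next
    case False
    then obtain w where w: "core w a b" using core_cover ab by blast
    then have "split_colour (Old w) (Old a) (Old b)" by simp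
    then show ?thesis using Old_X w core_in by blast
  qed
  consider a b where "u = Old a" "v = Old b" "a \<in> points r" "b \<in> points r" "fst a = fst b" "a \<noteq> b"
    | a where "u = Old a" "v = Inf s" "a \<in> points r" "fst a = s"
    | a where "u = Inf s" "v = Old a" "a \<in> points r" "fst a = s"
    using assms by (auto simp: part_def)
  then show ?thesis
  proof cases
    case 1 then show ?thesis using Old by simp
  next
    case 2 then show ?thesis using Inf by simp
  next
    case 3 then show ?thesis using Inf split_colour_sym by blast
  qed
qed

lemma matching_scheme_order_4k_plus_4:
  "\<exists>M. matching_scheme (part True \<union> part False) (2 * k + 2) (\<noteq>) M"
proof -
  obtain S :: "nat \<Rightarrow> (bool \<times> int) ext \<Rightarrow> (bool \<times> int) ext \<Rightarrow> bool" where
     S_sym: "\<forall>c u v. S c u v \<longrightarrow> S c v u" and S_uniq: "\<forall>c u v v'. S c u v \<longrightarrow> S c u v' \<longrightarrow> v = v'"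
     and S_X: "\<forall>u\<in>part True. \<forall>v\<in>part False. \<exists>c<2 * k + 2. S c u v"
    using bipartite_matchings[OF part_sides(1) part_sides(1) part_sides(3) part_sides(2) part_sides(2)] by metis
  have "matching_scheme (part True \<union> part False) (2 * k + 2) (\<noteq>) (case_sum split_colour S)"
    using split_colour_sym split_colour_uniq split_colour_anti S_sym S_uniq
  proof (rule matching_scheme_combine)
    fix u v assume "u \<in> part True \<union> part False" "v \<in> part True \<union> part False" "u \<noteq> v"
    then show "(\<exists>w \<in> part True \<union> part False. split_colour w u v) \<or> (\<exists>b<2 * k + 2. S b u v)"
      using split_colour_cover S_X S_sym by (metis UnE)
  qed
  then show ?thesis by blast
qed

end

section \<open>Cyclic frames on 4k + 2 points\<close>

text \<open>Case \<open>k = 2g + 1\<close>. The differences covered in the half \<open>True\<close> are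
  \<open>1, \<dots>, k - 1\<close>, those in the half \<open>False\<close> are \<open>1,
  \<dots>, k\<close>. Points of the half \<open>True\<close> whose difference is \<open>g +
  1\<close>, the unmatched midpoint, or its negative are unused pairs.\<close>

definition odd_rot :: "int \<Rightarrow> bool \<times> int \<Rightarrow> bool \<times> int \<Rightarrow> bool \<times> int \<Rightarrow> bool" where
  "odd_rot g w u v \<longleftrightarrow> fst u = fst v \<and>
     (if fst w = fst u then reflect (4 * g + 3) 1 (2 * g + 2) (snd w) (snd u) (snd v)
      else if fst u then reflect (4 * g + 3) 0 (2 * g - 1) (snd w) (snd u) (snd v)
      else reflect (4 * g + 3) 1 (2 * g + 3) (snd w) (snd u) (snd v))"

text \<open>The points 0 and \<open>k\<close> lie at the offsets \<open>g + 1\<close> and \<open>- (g +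
  1)\<close> from the point \<open>3g + 2\<close> modulo \<open>4g + 3\<close>, and
  \<open>odd_rot\<close> leaves both offsets unused.\<close>

definition odd_extra :: "int \<Rightarrow> bool \<times> int \<Rightarrow> bool \<times> int \<Rightarrow> bool \<times> int \<Rightarrow> bool" where
  "odd_extra g w u v \<longleftrightarrow> w = (True, 3 * g + 2) \<and>
     (u = (True, 0) \<and> v = (True, 2 * g + 1) \<or> v = (True, 0) \<and> u = (True, 2 * g + 1))"

text \<open>Case \<open>k = 2g\<close>. Here the points of the half \<open>False\<close> whose difference
  is \<open>g\<close>, the unmatched midpoint, or its negative are unused pairs.\<close>

definition even_reflect :: "int \<Rightarrow> bool \<times> int \<Rightarrow> bool \<times> int \<Rightarrow> bool \<times> int \<Rightarrow> bool" where
  "even_reflect g w u v \<longleftrightarrow> fst u = fst v \<and>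
     (if fst w \<and> fst u then reflect (4 * g + 1) 1 (2 * g + 1) (snd w) (snd u) (snd v)
      else if fst u then reflect (4 * g + 1) 0 (2 * g - 2) (snd w) (snd u) (snd v)
      else if fst w then reflect (4 * g + 1) 1 (2 * g + 3) (snd w) (snd u) (snd v)
      else reflect (4 * g + 1) 1 (2 * g) (snd w) (snd u) (snd v))"

text \<open>All pairs of points from different halves are in use. To colour the edge between the points 0
  and \<open>k\<close> of the half \<open>True\<close>, the point 1 of the half
  \<open>False\<close> has to be freed from these two colours. Two edges are therefore taken
  away from them; they pass to other colours in \<open>even_extra\<close>.\<close>

definition even_rot :: "int \<Rightarrow> bool \<times> int \<Rightarrow> bool \<times> int \<Rightarrow> bool \<times> int \<Rightarrow> bool" where
  "even_rot g w u v \<longleftrightarrow> even_reflect g w u v \<and>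
     (w, {u, v}) \<notin> {((True, 0), {(False, 1), (False, 2 * g + 2)}),
       ((True, 2 * g), {(False, 1), (False, 2 * g + 1)})}"

text \<open>The point 1 of the half \<open>False\<close> colours the edge between the points 0 and
  \<open>k\<close> of the half \<open>True\<close>. The removed edges join points of the half
  \<open>False\<close> at cyclic distance \<open>2g\<close>, and the points halfway between
  their ends, \<open>1 - g\<close> and \<open>1 + g\<close>, see both ends at the unused offsets
  \<open>\<plusminus> g\<close>. The term \<open>offset (4 * g + 1) g 1\<close> is the residue
  of \<open>1 - g\<close>.\<close>

definition even_extra :: "int \<Rightarrow> bool \<times> int \<Rightarrow> bool \<times> int \<Rightarrow> bool \<times> int \<Rightarrow> bool" where
  "even_extra g w u v \<longleftrightarrow>
     (w, {u, v}) \<in> {((False, 1), {(True, 0), (True, 2 * g)}),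
       ((False, offset (4 * g + 1) g 1), {(False, 1), (False, 2 * g + 2)}),
       ((False, g + 1), {(False, 1), (False, 2 * g + 1)})}"

lemma offset_small:
  assumes "i \<in> {0..<r}" "j \<in> {0..<r}" "i \<noteq> j"
  shows "offset r i j + offset r j i = r"
  using assms by (auto simp: offset_def)

text \<open>A frame may be assembled from a rotational part \<open>R\<close> and a few exceptional edges
  \<open>T\<close>, provided no pair used by \<open>T\<close> is used by \<open>R\<close>.\<close>

lemma split_frameI:
  fixes k :: nat and K r :: int
  assumes "\<And>w u v. R w u v \<Longrightarrow> w \<in> points r \<and> u \<in> points r \<and> v \<in> points r"
    and "\<And>w u v. T w u v \<Longrightarrow> w \<in> points r \<and> u \<in> points r \<and> v \<in> points r"
    and "\<And>w u v. R w u v \<Longrightarrow> R w v u" and "\<And>w u v. T w u v \<Longrightarrow> T w v u"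
    and "\<And>w u v v'. R w u v \<Longrightarrow> R w u v' \<Longrightarrow> v = v'" and "\<And>w u v v'. T w u v \<Longrightarrow> T w u v' \<Longrightarrow> v = v'"
    and "\<And>w u v v'. R w u v \<Longrightarrow> \<not> R u w v'" and "\<And>w u v v'. T w u v \<Longrightarrow> \<not> T u w v'"
    and "\<And>w u v v'. T w u v \<Longrightarrow> \<not> R w u v' \<and> \<not> R u w v'"
    and "\<And>w u v. \<not> fst w \<Longrightarrow> offset (r) (snd w) (snd u) = d (fst u) \<Longrightarrow> \<not> R w u v \<and> \<not> R u w v"
    and "\<And>w u v. \<not> fst w \<Longrightarrow> offset (r) (snd w) (snd u) = d (fst u) \<Longrightarrow> \<not> T w u v \<and> \<not> T u w v"
    and "\<And>i j. i \<in> {0..<r} \<Longrightarrow> j \<in> {0..<r} \<Longrightarrow> i \<noteq> j \<Longrightarrow>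
       offset (r) i j < K \<Longrightarrow> \<exists>w. R w (True, i) (True, j)"
    and "\<And>i j. i \<in> {0..<r} \<Longrightarrow> j \<in> {0..<r} \<Longrightarrow> i \<noteq> j \<Longrightarrow>
       offset (r) i j \<le> K \<Longrightarrow> \<exists>w. R w (False, i) (False, j) \<or> T w (False, i) (False, j)"
    and "\<exists>w. T w (True, 0) (True, K)"
    and "\<And>s. 0 \<le> d s" "\<And>s. d s \<le> 2 * K" "d False \<noteq> 0"
    and K: "int k = K" and r: "2 * K + 1 = r"
  shows "split_frame k (\<lambda>w u v. R w u v \<or> T w u v) d"
proof (unfold_locales; (unfold K r)?)
  let ?C = "\<lambda>w u v. R w u v \<or> T w u v"
  show "\<exists>w. ?C w u v"
    if uv: "u \<in> points r" "v \<in> points r" "fst u = fst v" "u \<noteq> v"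
      and gap: "fst u \<longrightarrow> \<bar>snd u - snd v\<bar> \<notin> {K, K + 1}" for u v
  proof -
    obtain s i j where ij: "u = (s, i)" "v = (s, j)" using uv(3) by (cases u; cases v) auto
    have range: "i \<in> {0..<r}" "j \<in> {0..<r}" "i \<noteq> j"
      using uv unfolding ij by (auto simp: points_def)
    show ?thesis
    proof (cases s)
      case True
      have "offset (r) i j < K \<or> offset (r) j i < K"
        using gap range True r unfolding ij by (auto simp: offset_def)
      then have "\<exists>w. R w (True, i) (True, j)"
        using assms(12)[OF range] assms(12)[OF range(2,1) range(3)[symmetric]] assms(3) by metis
      then show ?thesis using True unfolding ij by auto
    next
      case False
      have "offset (r) i j \<le> K \<or> offset (r) j i \<le> K"
        using range r by (auto simp: offset_def)
      then have "\<exists>w. ?C w (False, i) (False, j)"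
        using assms(13)[OF range] assms(13)[OF range(2,1) range(3)[symmetric]] assms(3,4) by metis
      then show ?thesis using False unfolding ij by auto
    qed
  qed
  show "\<exists>w. ?C w (True, 0) (True, K)" using assms(14) by blast
  show "w \<in> points r \<and> u \<in> points r \<and> v \<in> points r"
    if "?C w u v" for w u v using that assms(1,2) by blast
  show "?C w v u" if "?C w u v" for w u v using that assms(3,4) by blast
  show "v = v'" if "?C w u v" "?C w u v'" for w u v v' using that assms(5,6,9) by blast
  show "\<not> ?C u w v'" if "?C w u v" for w u v v' using that assms(7,8,9) by blast
  show "\<not> ?C w u v \<and> \<not> ?C u w v"
    if "\<not> fst w" "offset (r) (snd w) (snd u) = d (fst u)" for w u v
    using assms(10,11)[OF that] by blast
qed (fact assms(15-17))+

lemma split_frame_odd: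
  fixes n :: nat
  defines "g \<equiv> int n"
  shows "split_frame (2 * n + 1) (\<lambda>w u v. odd_rot g w u v \<or> odd_extra g w u v)
    (\<lambda>s. if s then 2 * g else g + 1)"
proof (rule split_frameI[where K = "2 * g + 1" and r = "4 * g + 3"])
  have g: "0 \<le> g" by (simp add: g_def)
  fix w u v :: "bool \<times> int"
  show "w \<in> points (4 * g + 3) \<and> u \<in> points (4 * g + 3) \<and> v \<in> points (4 * g + 3)"
    if "odd_rot g w u v"
    using that
    by (cases w; cases u; cases v) (auto simp: odd_rot_def points_def reflect_def split: if_splits)
  show "w \<in> points (4 * g + 3) \<and> u \<in> points (4 * g + 3) \<and> v \<in> points (4 * g + 3)"
    if "odd_extra g w u v"
    using that g by (auto simp: odd_extra_def points_def)
  show "odd_rot g w v u" if "odd_rot g w u v"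
    using that by (auto simp: odd_rot_def intro: reflect_sym)
  show "odd_extra g w v u" if "odd_extra g w u v"
    using that by (auto simp: odd_extra_def)
  show "v = v'" if "odd_rot g w u v" "odd_rot g w u v'" for v'
    using that by (cases v; cases v') (auto simp: odd_rot_def split: if_splits dest: reflect_uniq)
  show "v = v'" if "odd_extra g w u v" "odd_extra g w u v'" for v'
    using that g by (auto simp: odd_extra_def)
  show "\<not> odd_rot g u w v'" if "odd_rot g w u v" for v'
    using that by (auto simp: odd_rot_def reflect_def offset_def split: if_splits)
  show "\<not> odd_extra g u w v'" if "odd_extra g w u v" for v'
    using that g by (auto simp: odd_extra_def)
  show "\<not> odd_rot g w u v' \<and> \<not> odd_rot g u w v'" if "odd_extra g w u v" for v'
    using that g by (auto simp: odd_rot_def odd_extra_def reflect_def offset_def split: if_splits)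
  show "\<not> odd_rot g w u v \<and> \<not> odd_rot g u w v"
    if "\<not> fst w" "offset (4 * g + 3) (snd w) (snd u) = (if fst u then 2 * g else g + 1)"
    using that g by (auto simp: odd_rot_def reflect_def offset_def split: if_splits)
  show "\<not> odd_extra g w u v \<and> \<not> odd_extra g u w v"
    if "\<not> fst w" "offset (4 * g + 3) (snd w) (snd u) = (if fst u then 2 * g else g + 1)"
    using that g by (auto simp: odd_extra_def offset_def split: if_splits)
next
  have g: "0 \<le> g" by (simp add: g_def)
  fix i j :: int
  assume ij: "i \<in> {0..<4 * g + 3}" "j \<in> {0..<4 * g + 3}" "i \<noteq> j"
    and "offset (4 * g + 3) i j < 2 * g + 1"
  then have d: "offset (4 * g + 3) i j \<le> 2 * g" by simp
  show "\<exists>w. odd_rot g w (True, i) (True, j)"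
  proof (cases "even (offset (4 * g + 3) i j)")
    case True
    then obtain w where "reflect (4 * g + 3) 1 (2 * g + 2) w i j"
      using reflect_cover[OF ij, of 1 "2 * g + 2"] g d by auto
    then have "odd_rot g (True, w) (True, i) (True, j)" by (simp add: odd_rot_def)
    then show ?thesis ..
  next
    case False
    then have "offset (4 * g + 3) i j \<le> 2 * g - 1" using d by presburger
    then obtain w where "reflect (4 * g + 3) 0 (2 * g - 1) w i j"
      using reflect_cover[OF ij, of 0 "2 * g - 1"] g False g by auto
    then have "odd_rot g (False, w) (True, i) (True, j)" by (simp add: odd_rot_def)
    then show ?thesis ..
  qed
next
  have g: "0 \<le> g" by (simp add: g_def)
  fix i j :: int
  assume ij: "i \<in> {0..<4 * g + 3}" "j \<in> {0..<4 * g + 3}" "i \<noteq> j"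
    and "offset (4 * g + 3) i j \<le> 2 * g + 1"
  then have d: "offset (4 * g + 3) i j \<le> 2 * g + 1" by simp
  show "\<exists>w. odd_rot g w (False, i) (False, j) \<or> odd_extra g w (False, i) (False, j)"
  proof (cases "even (offset (4 * g + 3) i j)")
    case True
    then have "offset (4 * g + 3) i j \<le> 2 * g" using d by presburger
    then obtain w where "reflect (4 * g + 3) 1 (2 * g + 2) w i j"
      using reflect_cover[OF ij, of 1 "2 * g + 2"] g True by auto
    then have "odd_rot g (False, w) (False, i) (False, j)" by (simp add: odd_rot_def)
    then show ?thesis by blast
  next
    case False
    then obtain w where "reflect (4 * g + 3) 1 (2 * g + 3) w i j"
      using reflect_cover[OF ij, of 1 "2 * g + 3"] g d g by auto
    then have "odd_rot g (True, w) (False, i) (False, j)" by (simp add: odd_rot_def)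
    then show ?thesis by blast
  qed
next
  show "\<exists>w. odd_extra g w (True, 0) (True, 2 * g + 1)" by (auto simp: odd_extra_def)
qed (auto simp: g_def)

lemma even_extra_iff:
  "even_extra g w u v \<longleftrightarrow>
     w = (False, 1) \<and> (u = (True, 0) \<and> v = (True, 2 * g) \<or> v = (True, 0) \<and> u = (True, 2 * g)) \<or>
     w = (False, offset (4 * g + 1) g 1) \<and>
       (u = (False, 1) \<and> v = (False, 2 * g + 2) \<or> v = (False, 1) \<and> u = (False, 2 * g + 2)) \<or>
     w = (False, g + 1) \<and>
       (u = (False, 1) \<and> v = (False, 2 * g + 1) \<or> v = (False, 1) \<and> u = (False, 2 * g + 1))"
  by (auto simp: even_extra_def doubleton_eq_iff)

lemma split_frame_even:
  fixes n :: nat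
  assumes "n \<ge> 1"
  defines "g \<equiv> int n"
  shows "split_frame (2 * n) (\<lambda>w u v. even_rot g w u v \<or> even_extra g w u v)
    (\<lambda>s. if s then g - 1 else 2 * g)"
proof (rule split_frameI[where K = "2 * g" and r = "4 * g + 1"])
  have g: "1 \<le> g" using assms by simp
  define c where "c = offset (4 * g + 1) g 1"
  have c: "g = 1 \<and> c = 0 \<or> g \<ge> 2 \<and> c = 3 * g + 2" using g by (auto simp: c_def offset_def)
  note extra = even_extra_iff[of g, folded c_def]
  fix w u v :: "bool \<times> int"
  show "w \<in> points (4 * g + 1) \<and> u \<in> points (4 * g + 1) \<and> v \<in> points (4 * g + 1)"
    if "even_rot g w u v"
    using that
    by (cases w; cases u; cases v)
      (auto simp: even_rot_def even_reflect_def points_def reflect_def split: if_splits)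
  show "w \<in> points (4 * g + 1) \<and> u \<in> points (4 * g + 1) \<and> v \<in> points (4 * g + 1)"
    if "even_extra g w u v"
    using that g c unfolding extra by (elim disjE conjE) (simp_all add: points_def)
  show "even_rot g w v u" if "even_rot g w u v"
    using that by (simp add: even_rot_def insert_commute even_reflect_def reflect_sym split: if_splits)
  show "even_extra g w v u" if "even_extra g w u v"
    using that by (simp add: even_extra_def insert_commute)
  show "v = v'" if "even_rot g w u v" "even_rot g w u v'" for v'
  proof -
    have "even_reflect g w u v" "even_reflect g w u v'" using that by (simp_all add: even_rot_def)
    then show ?thesis
      by (cases v; cases v') (auto simp: even_reflect_def split: if_splits dest: reflect_uniq)
  qed
  show "v = v'" if "even_extra g w u v" "even_extra g w u v'" for v'
    using that g c unfolding extra by (elim disjE conjE) simp_all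
  show "\<not> even_rot g u w v'" if "even_rot g w u v" for v'
  proof -
    have "even_reflect g w u v" using that by (simp add: even_rot_def)
    then have "\<not> even_reflect g u w v'"
      by (auto simp: even_reflect_def reflect_def offset_def split: if_splits)
    then show ?thesis by (simp add: even_rot_def)
  qed
  show "\<not> even_extra g u w v'" if "even_extra g w u v" for v'
    using that g c unfolding extra by (elim disjE conjE) simp_all
  show "\<not> even_rot g w u v' \<and> \<not> even_rot g u w v'" if "even_extra g w u v" for v'
  proof -
    note rot = even_rot_def even_reflect_def reflect_def offset_def
    have "w = (False, 1) \<and> u = (True, 0) \<or> w = (False, 1) \<and> u = (True, 2 * g) \<or>
        w = (False, c) \<and> u = (False, 1) \<or> w = (False, c) \<and> u = (False, 2 * g + 2) \<or>
        w = (False, g + 1) \<and> u = (False, 1) \<or> w = (False, g + 1) \<and> u = (False, 2 * g + 1)"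
      using that unfolding extra by blast
    then consider "w = (False, 1)" "u = (True, 0)" | "w = (False, 1)" "u = (True, 2 * g)"
      | "w = (False, c)" "u = (False, 1)" | "w = (False, c)" "u = (False, 2 * g + 2)"
      | "w = (False, g + 1)" "u = (False, 1)" | "w = (False, g + 1)" "u = (False, 2 * g + 1)"
      by blast
    then show ?thesis
    proof cases
      case 1
      then show ?thesis using g by (cases v') (auto simp: rot split: if_splits)
    next
      case 2
      then show ?thesis using g by (cases v') (auto simp: rot split: if_splits)
    next
      case 3
      then show ?thesis using g c by (cases v') (auto simp: rot split: if_splits)
    next
      case 4
      then show ?thesis using g c by (cases v') (auto simp: rot split: if_splits)
    next
      case 5
      then show ?thesis using g by (cases v') (auto simp: rot split: if_splits)
    next
      case 6
      then show ?thesis using g by (cases v') (auto simp: rot split: if_splits)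
    qed
  qed
  show "\<not> even_rot g w u v \<and> \<not> even_rot g u w v"
    if "\<not> fst w" "offset (4 * g + 1) (snd w) (snd u) = (if fst u then g - 1 else 2 * g)"
  proof -
    have "\<not> even_reflect g w u v \<and> \<not> even_reflect g u w v"
      using that g by (auto simp: even_reflect_def reflect_def offset_def split: if_splits)
    then show ?thesis by (simp add: even_rot_def)
  qed
  show "\<not> even_extra g w u v \<and> \<not> even_extra g u w v"
    if "\<not> fst w" "offset (4 * g + 1) (snd w) (snd u) = (if fst u then g - 1 else 2 * g)"
    using that g c unfolding extra by (auto simp: offset_def split: if_splits)
next
  have g: "1 \<le> g" using assms by simp
  fix i j :: int
  assume ij: "i \<in> {0..<4 * g + 1}" "j \<in> {0..<4 * g + 1}" "i \<noteq> j"
    and "offset (4 * g + 1) i j < 2 * g"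
  then have d: "offset (4 * g + 1) i j < 2 * g" by simp
  show "\<exists>w. even_rot g w (True, i) (True, j)"
  proof (cases "odd (offset (4 * g + 1) i j)")
    case True
    then obtain w where "reflect (4 * g + 1) 1 (2 * g + 1) w i j"
      using reflect_cover[OF ij, of 1 "2 * g + 1"] g d g by auto
    then have "even_rot g (True, w) (True, i) (True, j)" by (simp add: even_rot_def even_reflect_def doubleton_eq_iff)
    then show ?thesis ..
  next
    case False
    then have "offset (4 * g + 1) i j \<le> 2 * g - 2" using d by presburger
    then obtain w where "reflect (4 * g + 1) 0 (2 * g - 2) w i j"
      using reflect_cover[OF ij, of 0 "2 * g - 2"] g False g by auto
    then have "even_rot g (False, w) (True, i) (True, j)" by (simp add: even_rot_def even_reflect_def doubleton_eq_iff)
    then show ?thesis ..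
  qed
next
  have g: "1 \<le> g" using assms by simp
  have Y: "\<exists>w. even_rot g w (False, i) (False, j) \<or> even_extra g w (False, i) (False, j)"
    if "reflect (4 * g + 1) 1 (2 * g + 3) w i j" for w i j
  proof (cases "{(False, i), (False, j)} \<in> {{(False, 1), (False, 2 * g + 2)}, {(False, 1), (False, 2 * g + 1)}}")
    case True
    then consider "{(False, i), (False, j)} = {(False, 1), (False, 2 * g + 2)}"
      | "{(False, i), (False, j)} = {(False, 1), (False, 2 * g + 1)}"
      by blast
    then show ?thesis
    proof cases
      case 1
      have "even_extra g (False, offset (4 * g + 1) g 1) (False, i) (False, j)"
        unfolding even_extra_def 1 by blast
      then show ?thesis by blast
    next
      case 2
      have "even_extra g (False, g + 1) (False, i) (False, j)"
        unfolding even_extra_def 2 by blast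
      then show ?thesis by blast
    qed
  next
    case False
    then have "even_rot g (True, w) (False, i) (False, j)"
      using that unfolding even_rot_def even_reflect_def by simp
    then show ?thesis by blast
  qed
  fix i j :: int
  assume ij: "i \<in> {0..<4 * g + 1}" "j \<in> {0..<4 * g + 1}" "i \<noteq> j"
    and "offset (4 * g + 1) i j \<le> 2 * g"
  then have d: "offset (4 * g + 1) i j \<le> 2 * g" by simp
  have "x = 2 * g \<or> even x \<and> x \<le> 2 * g - 2 \<or> odd x" if "x \<le> 2 * g" for x :: int
    using that by presburger
  from this[OF d] consider "offset (4 * g + 1) i j = 2 * g"
    | "even (offset (4 * g + 1) i j)" "offset (4 * g + 1) i j \<le> 2 * g - 2"
    | "odd (offset (4 * g + 1) i j)"
    by blast
  then show "\<exists>w. even_rot g w (False, i) (False, j) \<or> even_extra g w (False, i) (False, j)"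
  proof cases
    case 1
    \<comment> \<open>The even difference \<open>2 * g\<close> is too large for colours of the same half, but read
      backwards it is the odd difference \<open>2 * g + 1\<close>.\<close>
    then have "offset (4 * g + 1) j i = 2 * g + 1" using offset_small[OF ij] by simp
    then obtain w where "reflect (4 * g + 1) 1 (2 * g + 3) w j i"
      using reflect_cover[OF ij(2,1) ij(3)[symmetric], of 1 "2 * g + 3"] g by auto
    then show ?thesis using Y reflect_sym by blast
  next
    case 2
    then obtain w where "reflect (4 * g + 1) 1 (2 * g) w i j"
      using reflect_cover[OF ij, of 1 "2 * g"] g by auto
    then have "even_rot g (False, w) (False, i) (False, j)" by (simp add: even_rot_def even_reflect_def doubleton_eq_iff)
    then show ?thesis by blast
  next
    case 3
    then have "offset (4 * g + 1) i j \<le> 2 * g + 1" using d by simp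
    then obtain w where "reflect (4 * g + 1) 1 (2 * g + 3) w i j"
      using reflect_cover[OF ij, of 1 "2 * g + 3"] g g 3 by auto
    then show ?thesis using Y by blast
  qed
next
  show "\<exists>w. even_extra g w (True, 0) (True, 2 * g)" by (auto simp: even_extra_def)
qed (use assms in auto)

section \<open>Small orders and the bound\<close>

lemma harmonious_bound_complete:
  fixes G :: "'a ugraph" and V :: "'v set"
  assumes G: "finite_simple_graph G" and V: "finite V" "card V = order_of G"
    and S: "matching_scheme V q (\<noteq>) M"
  shows "harmonious_total_chromatic_number G \<le> order_of G + q"
proof -
  obtain f where f: "bij_betw f (verts G) V"
    using G V finite_same_card_bij[of "verts G" V]
    by (auto simp: finite_simple_graph_def order_of_def)
  have "f u \<noteq> f v" if "{u, v} \<in> edges G" for u v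
  proof -
    have "{u, v} \<subseteq> verts G" "card {u, v} = 2"
      using G that by (auto simp: finite_simple_graph_def)
    then have "u \<in> verts G" "v \<in> verts G" "u \<noteq> v" by auto
    then show ?thesis using f by (auto simp: bij_betw_def inj_on_def)
  qed
  then show ?thesis using harmonious_bound_of_scheme[OF G f _ S] by blast
qed

definition listed :: "('c \<times> 'v \<times> 'v) list \<Rightarrow> 'c \<Rightarrow> 'v \<Rightarrow> 'v \<Rightarrow> bool" where
  "listed xs c u v \<longleftrightarrow> (c, u, v) \<in> set xs \<or> (c, v, u) \<in> set xs"

lemma matching_scheme_listed:
  assumes "\<And>c u v v'. listed xs c u v \<Longrightarrow> listed xs c u v' \<Longrightarrow> v = v'"
    and "\<And>u w v v'. listed xs (Inl w) u v \<Longrightarrow> listed xs (Inl u) w v' \<Longrightarrow> False"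
    and "\<And>c u v. (c, u, v) \<in> set xs \<Longrightarrow> c \<in> V <+> {..<q}"
    and "\<And>u v. u \<in> V \<Longrightarrow> v \<in> V \<Longrightarrow> u \<noteq> v \<Longrightarrow> E u v \<Longrightarrow> \<exists>c. listed xs c u v"
  shows "matching_scheme V q E (listed xs)"
  unfolding matching_scheme_def
proof (intro conjI allI impI ballI notI)
  show "listed xs c v u" if "listed xs c u v" for c u v
    using that by (auto simp: listed_def)
  show "\<exists>c\<in>V <+> {..<q}. listed xs c u v" if "u \<in> V" "v \<in> V" "u \<noteq> v" "E u v" for u v
    using assms(4)[OF that] assms(3) by (meson listed_def)
qed (fact assms(1,2))+

text \<open>The construction for order \<open>4h + 1\<close> with \<open>h = 1\<close>: the halves are
  \<open>{0, 1}\<close> and \<open>{2, 3}\<close>, the apex is 4, and it is joined to 0 and 2 by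
  extra colours.\<close>

lemma matching_scheme_order_5:
  "matching_scheme {..<5 :: nat} 3 (\<noteq>)
     (listed [(Inl 2, 0, 1), (Inl 4, 2, 3), (Inl 0, 1, 4), (Inl 1, 3, 4), (Inr 0, 0, 2),
       (Inr 0, 1, 3), (Inr 1, 0, 3), (Inr 1, 2, 4), (Inr 2, 1, 2), (Inr 2, 0, 4)])"
proof (rule matching_scheme_listed)
  fix u v :: nat assume "u \<in> {..<5}" "v \<in> {..<5}" "u \<noteq> v"
  then have "u \<in> {0, 1, 2, 3, 4}" "v \<in> {0, 1, 2, 3, 4}" by auto
  then show "\<exists>c. listed [(Inl 2, 0, 1), (Inl 4, 2, 3), (Inl 0, 1, 4), (Inl 1, 3, 4), (Inr 0, 0, 2),
       (Inr 0, 1, 3), (Inr 1, 0, 3), (Inr 1, 2, 4), (Inr 2, 1, 2), (Inr 2, 0, 4)] c u v"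
    using \<open>u \<noteq> v\<close> by (elim insertE emptyE) (simp_all add: listed_def ex_disj_distrib)
qed (auto simp: listed_def)

text \<open>The extra colours properly colour the 4-cycle between \<open>{0, 1}\<close> and \<open>{2,
  3}\<close>, and the edge from 2 to 3 gets the colour of the vertex 0.\<close>

lemma matching_scheme_order_4:
  "matching_scheme {..<4 :: nat} 2 (\<lambda>u v. {u, v} \<noteq> {0, 1})
     (listed [(Inl 0, 2, 3), (Inr 0, 0, 2), (Inr 0, 1, 3), (Inr 1, 0, 3), (Inr 1, 1, 2)])"
proof (rule matching_scheme_listed)
  fix u v :: nat assume "u \<in> {..<4}" "v \<in> {..<4}" "u \<noteq> v" and edge: "{u, v} \<noteq> {0, 1}"
  then have "u \<in> {0, 1, 2, 3}" "v \<in> {0, 1, 2, 3}" by auto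
  then show "\<exists>c. listed [(Inl 0, 2, 3), (Inr 0, 0, 2), (Inr 0, 1, 3), (Inr 1, 0, 3), (Inr 1, 1, 2)] c u v"
    using \<open>u \<noteq> v\<close> edge
    by (elim insertE emptyE) (simp_all add: listed_def ex_disj_distrib insert_commute)
qed (auto simp: listed_def)

lemma bound_order_mod_4:
  fixes G :: "'a ugraph" and h :: nat
  assumes G: "finite_simple_graph G"
  shows "order_of G = 4 * h + 1 \<Longrightarrow> h \<noteq> 1 \<Longrightarrow> harmonious_total_chromatic_number G \<le> order_of G + (2 * h + 1)"
    and "order_of G = 4 * h + 2 \<Longrightarrow> harmonious_total_chromatic_number G \<le> order_of G + (2 * h + 1)"
    and "order_of G = 4 * h + 3 \<Longrightarrow> harmonious_total_chromatic_number G \<le> order_of G + (2 * h + 2)"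
proof -
  interpret F: quartered_frame "points (2 * int h)" h fst "rotational (int h)" "quarter_turn (int h)" "quarter (int h)"
    by (rule quartered_frame_rotational)
  have Old: "finite (Old ` points (2 * int h))" "card (Old ` points (2 * int h)) = 4 * h"
    using F.fin F.card_V by (auto simp: card_image inj_on_def)
  have part: "finite (F.part True \<union> F.part False)" "card (F.part True \<union> F.part False) = 4 * h + 2"
    using F.part_sides F.card_part by auto
  have Apex: "Apex \<notin> Old ` points (2 * int h)" "Apex \<notin> F.part True \<union> F.part False"
    by (auto simp: F.part_def)
  show "harmonious_total_chromatic_number G \<le> order_of G + (2 * h + 1)"
    if "order_of G = 4 * h + 1" "h \<noteq> 1"
    using F.matching_scheme_order_4h_plus_1[OF that(2)] harmonious_bound_complete[OF G] Old Apex that(1)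
    by (metis card_insert_disjoint finite_insert Suc_eq_plus1)
  show "harmonious_total_chromatic_number G \<le> order_of G + (2 * h + 1)"
    if "order_of G = 4 * h + 2"
    using F.matching_scheme_order_4h_plus_2 harmonious_bound_complete[OF G] part that by metis
  have "card (insert Apex (F.part True \<union> F.part False)) = 4 * h + 3" using part Apex by simp
  then show "harmonious_total_chromatic_number G \<le> order_of G + (2 * h + 2)"
    if "order_of G = 4 * h + 3"
    using F.matching_scheme_order_4h_plus_3 harmonious_bound_complete[OF G] part that
    by (metis finite_insert)
qed

lemma bound_of_split_frame:
  fixes G :: "'a ugraph"
  assumes G: "finite_simple_graph G" "order_of G = 4 * k + 4" and F: "split_frame k core d"
  shows "harmonious_total_chromatic_number G \<le> order_of G + (2 * k + 2)"
proof -
  interpret F: split_frame k core d by (rule F)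
  have "finite (F.part True \<union> F.part False)" "card (F.part True \<union> F.part False) = order_of G"
    using F.part_sides F.card_part G by auto
  then show ?thesis
    using F.matching_scheme_order_4k_plus_4 harmonious_bound_complete[OF G(1)] by metis
qed

text \<open>A graph of order 4 other than \<open>K\<^sub>4\<close> misses some edge; the vertices are
  numbered so that the missing edge joins 0 and 1.\<close>

lemma bound_order_4:
  fixes G :: "'a ugraph"
  assumes G: "finite_simple_graph G" and order: "order_of G = 4"
    and not_K4: "\<not> isomorphic G (complete_graph 4)"
  shows "harmonious_total_chromatic_number G \<le> order_of G + 2"
proof -
  have fin: "finite (verts G)" and card: "card (verts G) = 4"
    using G order by (auto simp: finite_simple_graph_def order_of_def)
  have "\<exists>a\<in>verts G. \<exists>b\<in>verts G. a \<noteq> b \<and> {a, b} \<notin> edges G"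
  proof (rule ccontr)
    assume none: "\<not> ?thesis"
    have complete: "{u, v} \<in> edges G \<longleftrightarrow> u \<noteq> v" if "u \<in> verts G" "v \<in> verts G" for u v
    proof
      assume "{u, v} \<in> edges G"
      then have "card {u, v} = 2" using G by (simp add: finite_simple_graph_def)
      then show "u \<noteq> v" by auto
    qed (use none that in blast)
    obtain f where f: "bij_betw f (verts G) {..<4 :: nat}"
      using fin card finite_same_card_bij[of "verts G" "{..<4 :: nat}"] by auto
    have "{u, v} \<in> edges G \<longleftrightarrow> {f u, f v} \<in> edges (complete_graph 4)"
      if "u \<in> verts G" "v \<in> verts G" for u v
      using complete[OF that] that f
      by (auto simp: edges_def complete_graph_def bij_betw_def inj_on_def card_2_iff)
    moreover have "verts (complete_graph 4) = {..<4}" by (simp add: verts_def complete_graph_def)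
    ultimately have "isomorphic G (complete_graph 4)" unfolding isomorphic_def using f by metis
    then show False using not_K4 by simp
  qed
  then obtain a b where ab: "a \<in> verts G" "b \<in> verts G" "a \<noteq> b" "{a, b} \<notin> edges G" by blast
  have "card (verts G - {a, b}) = 2" using ab card fin by (simp add: card_Diff_subset)
  then obtain g where g: "bij_betw g (verts G - {a, b}) {2, 3 :: nat}"
    using fin finite_same_card_bij[of "verts G - {a, b}" "{2, 3 :: nat}"] by auto
  define f where "f u = (if u = a then 0 else if u = b then 1 else g u)" for u
  have "bij_betw f ({a, b} \<union> (verts G - {a, b})) ({0, 1} \<union> {2, 3})"
  proof (rule bij_betw_combine)
    show "bij_betw f {a, b} {0, 1}" using ab(3) by (auto simp: bij_betw_def f_def)
    show "bij_betw f (verts G - {a, b}) {2, 3}"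
      using g by (subst bij_betw_cong[of _ _ g]) (auto simp: f_def)
  qed auto
  moreover have "{a, b} \<union> (verts G - {a, b}) = verts G" using ab by auto
  moreover have "{0, 1} \<union> {2, 3} = {..<4 :: nat}" by auto
  ultimately have f: "bij_betw f (verts G) {..<4}" by simp
  have "{f u, f v} \<noteq> {0, 1}" if uv: "{u, v} \<in> edges G" for u v
  proof
    assume eq: "{f u, f v} = {0, 1}"
    have V: "u \<in> verts G" "v \<in> verts G" using G uv by (auto simp: finite_simple_graph_def)
    have "f a = 0" "f b = 1" using ab(3) by (auto simp: f_def)
    then have "{f u, f v} = {f a, f b}" using eq by simp
    then have "{u, v} = {a, b}"
      using V ab(1,2) f by (auto simp: doubleton_eq_iff bij_betw_def inj_on_def)
    then show False using uv ab(4) by simp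
  qed
  then show ?thesis
    using harmonious_bound_of_scheme[OF G f _ matching_scheme_order_4] by blast
qed

theorem corollary3:
  fixes G :: "'a ugraph" and n :: nat
  assumes "finite_simple_graph G"
    and "order_of G = n"
    and "\<not> isomorphic G (complete_graph 1)"
    and "\<not> isomorphic G (complete_graph 4)"
  shows "int (harmonious_total_chromatic_number G) \<le> \<lceil>(3 / 2 :: real) * real n\<rceil>"
proof -
  note G = assms(1)
  have "\<exists>q. 2 * q \<le> n + 1 \<and> harmonious_total_chromatic_number G \<le> n + q"
  proof -
    consider "n \<le> 1" | "n = 4" | "n = 5" | k where "n = 4 * k + 4" "k \<ge> 1"
      | h where "n = 4 * h + 1" "h \<noteq> 1" | h where "n = 4 * h + 2" | h where "n = 4 * h + 3"
    proof -
      have "n mod 4 = 0 \<or> n mod 4 = 1 \<or> n mod 4 = 2 \<or> n mod 4 = 3" by presburger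
      moreover have "n = 4 * (n div 4) + n mod 4" by simp
      ultimately show thesis
        using that(1,2,3) that(4)[of "n div 4 - 1"] that(5-7)[of "n div 4"] by linarith
    qed
    then show ?thesis
    proof cases
      case 1
      have S: "matching_scheme {..<n} 0 (\<noteq>) (\<lambda>_ _ _. False)"
        using 1 by (intro matching_schemeI) auto
      then have "harmonious_total_chromatic_number G \<le> n + 0"
        using harmonious_bound_complete[OF G _ _ S] assms(2) by simp
      then show ?thesis by (intro exI[of _ 0]) simp
    next
      case 2
      then show ?thesis using bound_order_4[OF G _ assms(4)] assms(2) by (intro exI[of _ 2]) simp
    next
      case 3
      then show ?thesis
        using harmonious_bound_complete[OF G _ _ matching_scheme_order_5] assms(2)
        by (intro exI[of _ 3]) simp
    next
      case (4 k)
      have "\<exists>core d. split_frame k core d"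
      proof (cases "even k")
        case True
        then obtain g where "k = 2 * g" by blast
        then show ?thesis using split_frame_even[of g] 4 by auto
      next
        case False
        then obtain g where "k = 2 * g + 1" by (rule oddE)
        then show ?thesis using split_frame_odd[of g] by auto
      qed
      then have "harmonious_total_chromatic_number G \<le> n + (2 * k + 2)"
        using bound_of_split_frame[OF G] 4 assms(2) by metis
      then show ?thesis using 4 by (intro exI[of _ "2 * k + 2"]) simp
    next
      case (5 h)
      then show ?thesis using bound_order_mod_4(1)[OF G, of h] assms(2)
        by (intro exI[of _ "2 * h + 1"]) simp
    next
      case (6 h)
      then show ?thesis using bound_order_mod_4(2)[OF G, of h] assms(2)
        by (intro exI[of _ "2 * h + 1"]) simp
    next
      case (7 h)
      then show ?thesis using bound_order_mod_4(3)[OF G, of h] assms(2)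
        by (intro exI[of _ "2 * h + 2"]) simp
    qed
  qed
  then obtain q where q: "2 * q \<le> n + 1" "harmonious_total_chromatic_number G \<le> n + q" by blast
  have "real (n + q) - 1 < 3 / 2 * real n" using q(1) by linarith
  then have "int (n + q) \<le> \<lceil>(3 / 2 :: real) * real n\<rceil>" by (simp add: le_ceiling_iff)
  then show ?thesis using q(2) by linarith
qed

end
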